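(* Let $\delta\in(0,1)$, and let $X$ be a real random variable with finite second moment and $P(X\neq0)=\epsilon$. For each $\sigma_w>0$ let $\sigma_h$ denote the highest fixed point of $\Psi_{\lambda_*,p_*}(\sigma^2)$, i.e. the largest $\sigma$ with $\Psi_{\lambda_*,p_*}(\sigma^2)=\sigma^2$. If $\inf_{0\le p\le1}\overline{M}_p(\epsilon)<\delta$, then $$\lim_{\sigma_w^2\to0}\frac{\sigma_h^2}{\sigma_w^2}=\frac{1}{1-\frac{\epsilon}{\delta}}.$$
   Context: For $0\le p\le1$, $\lambda\ge0$, $u\in\mathbb{R}$: $\eta_p(u;\lambda)=\arg\min_{x\in\mathbb{R}}\frac12(u-x)^2+\lambda|x|^p$ (with $|x|^0=\mathbb{I}(x\neq0)$), the value $0$ being chosen when the minimizer is not unique. State evolution map with optimal adaptation policy $(\lambda_*(\sigma),p_*(\sigma))\in\arg\min_{\lambda\ge0,\,0\le p\le1}\mathbb{E}|\eta_p(X+\sigma Z;\lambda)-X|^2$: for $\sigma\ge0$, $$\Psi_{\lambda_*,p_*}(\sigma^2)=\sigma_w^2+\frac1\delta\inf_{\lambda\ge0,\,0\le p\le1}\mathbb{E}\left|\eta_p(X+\sigma Z;\lambda)-X\right|^2,$$ with $X$ and $Z\sim N(0,1)$ independent. $\overline{M}_p(\epsilon)=\inf_{\tau\ge0}\sup_{\mu\ge0}\left[(1-\epsilon)\mathbb{E}(\eta_p(Z;\tau))^2+\epsilon\,\mathbb{E}(\eta_p(\mu+Z;\tau)-\mu)^2\right]$ with $Z\sim N(0,1)$.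 *)

theory Defs
  imports "HOL-Probability.Probability"
begin

(* 0 powr p = 0 also for p = 0, and y powr 0 = 1 for y > 0, so \<bar>x\<bar> powr p
   obeys the convention that \<bar>x\<bar>^0 is the indicator of x \<noteq> 0. *)
definition lp_objective :: "real \<Rightarrow> real \<Rightarrow> real \<Rightarrow> real \<Rightarrow> real" where
  "lp_objective p lam u x = (u - x)\<^sup>2 / 2 + lam * \<bar>x\<bar> powr p"

(* A minimizer always exists for 0 \<le> p \<le> 1 and lam \<ge> 0, so the else branch is only
   the tie between 0 and a nonzero point. *)
definition eta :: "real \<Rightarrow> real \<Rightarrow> real \<Rightarrow> real" where
  "eta p u lam =
     (if \<exists>!x. is_arg_min (lp_objective p lam u) (\<lambda>_. True) x
      then THE x. is_arg_min (lp_objective p lam u) (\<lambda>_. True) x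
      else 0)"

definition risk :: "'a measure \<Rightarrow> ('a \<Rightarrow> real) \<Rightarrow> ('a \<Rightarrow> real) \<Rightarrow> real \<Rightarrow> real \<Rightarrow> real \<Rightarrow> real" where
  "risk M X Z \<sigma> lam p = (\<integral>\<omega>. \<bar>eta p (X \<omega> + \<sigma> * Z \<omega>) lam - X \<omega>\<bar>\<^sup>2 \<partial>M)"

(* The last argument is the variance \<sigma>\<^sup>2, not \<sigma>. *)
definition Psi :: "'a measure \<Rightarrow> ('a \<Rightarrow> real) \<Rightarrow> ('a \<Rightarrow> real) \<Rightarrow> real \<Rightarrow> real \<Rightarrow> real \<Rightarrow> real" where
  "Psi M X Z \<delta> \<sigma>w v =
     \<sigma>w\<^sup>2 + 1 / \<delta> * (INF (lam, p) \<in> {0..} \<times> {0..1}. risk M X Z (sqrt v) lam p)"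

definition highest_fixed_point ::
    "'a measure \<Rightarrow> ('a \<Rightarrow> real) \<Rightarrow> ('a \<Rightarrow> real) \<Rightarrow> real \<Rightarrow> real \<Rightarrow> real" where
  "highest_fixed_point M X Z \<delta> \<sigma>w =
     (GREATEST \<sigma>. 0 \<le> \<sigma> \<and> Psi M X Z \<delta> \<sigma>w (\<sigma>\<^sup>2) = \<sigma>\<^sup>2)"

(* For fixed tau \<ge> 0 the map u \<mapsto> eta p u tau - u is bounded, so the supremum over mu
   is that of a set bounded above and all integrals are finite. *)
definition Mbar :: "real \<Rightarrow> real \<Rightarrow> real" where
  "Mbar p \<epsilon> =
     (INF tau \<in> {0..}. SUP mu \<in> {0..}.
        (1 - \<epsilon>) * (\<integral>z. (eta p z tau)\<^sup>2 \<partial>std_normal_distribution)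
        + \<epsilon> * (\<integral>z. (eta p (mu + z) tau - mu)\<^sup>2 \<partial>std_normal_distribution))"

end

theory Submission
  imports Defs
begin

text \<open>
  Let \<open>V \<sigma>\<close> be the optimally tuned risk at noise level \<open>\<sigma>\<close>, so that the fixed point equation reads
  \<open>\<sigma>\<^sup>2 = \<sigma>w\<^sup>2 + V \<sigma> / \<delta>\<close>. Three facts about \<open>V\<close> suffice.

  By the scale equivariance of \<open>eta\<close>, the minimax threshold gives \<open>V \<sigma> \<le> D * \<sigma>\<^sup>2\<close> with a constant
  \<open>D < \<delta>\<close>; hence every fixed point is \<open>O(\<sigma>w)\<close>.

  The centred Gaussian density satisfies \<open>\<phi> (c * z) \<le> \<phi> z\<close> for \<open>c \<ge> 1\<close>, so \<open>\<sigma> * V \<sigma>\<close> is nondecreasing.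
  This monotonicity replaces continuity of \<open>V\<close> in the proof that a highest fixed point exists.

  Finally \<open>V \<sigma> / \<sigma>\<^sup>2\<close> tends to \<open>\<epsilon> = P(X \<noteq> 0)\<close> as \<open>\<sigma>\<close> tends to \<open>0\<close>. The upper bound comes from hard
  thresholding (\<open>p = 0\<close>) at level \<open>t * \<sigma>\<close> with \<open>t\<close> large. The lower bound is uniform in \<open>lam\<close> and \<open>p\<close>:
  where \<open>eta\<close> is nonzero it has slope at least \<open>1\<close>, so averaging the errors at \<open>X + \<sigma> * Z\<close> and
  \<open>X - \<sigma> * Z\<close> yields at least \<open>\<sigma>\<^sup>2 * Z\<^sup>2\<close> as soon as \<open>2 * \<bar>\<sigma> * Z\<bar> \<le> \<bar>X\<bar>\<close>.
\<close>

section \<open>The proximal map of the penalty\<close>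

definition lp_min :: "real \<Rightarrow> real \<Rightarrow> real \<Rightarrow> real \<Rightarrow> bool" where
  "lp_min p lam u x \<longleftrightarrow> (\<forall>y. lp_objective p lam u x \<le> lp_objective p lam u y)"

lemma is_arg_min_lp_objective:
  "is_arg_min (lp_objective p lam u) (\<lambda>_. True) x \<longleftrightarrow> lp_min p lam u x"
  by (auto simp: is_arg_min_def lp_min_def not_less)

lemma eta_lp_min:
  "eta p u lam = (if \<exists>!x. lp_min p lam u x then THE x. lp_min p lam u x else 0)"
  by (simp only: eta_def is_arg_min_lp_objective)

section \<open>Reflection and scaling symmetries\<close>

lemma lp_min_minus: "lp_min p lam (- u) (- x) \<longleftrightarrow> lp_min p lam u x"
proof -
  have eq: "lp_objective p lam (- u) (- y) = lp_objective p lam u y" for y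
    by (simp add: lp_objective_def power2_eq_square algebra_simps)
  show ?thesis
    unfolding lp_min_def by (metis eq minus_minus)
qed

text \<open>The quadratic term is homogeneous of degree 2 and the penalty of degree
  \<open>p\<close>; the factor \<open>s powr (2 - p)\<close> on the weight compensates the
  difference, so the whole objective is multiplied by \<open>s\<^sup>2\<close>.\<close>

lemma lp_min_scale:
  assumes "0 < s"
  shows "lp_min p (s powr (2 - p) * lam) (s * u) (s * x) \<longleftrightarrow> lp_min p lam u x"
proof -
  have eq: "lp_objective p (s powr (2 - p) * lam) (s * u) (s * y) = s\<^sup>2 * lp_objective p lam u y" for y
  proof -
    have "s powr (2 - p) * (s powr p * \<bar>y\<bar> powr p) = s\<^sup>2 * \<bar>y\<bar> powr p"
      using assms by (simp add: mult.assoc [symmetric] flip: powr_add)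
    then have "s powr (2 - p) * lam * \<bar>s * y\<bar> powr p = s\<^sup>2 * (lam * \<bar>y\<bar> powr p)"
      using assms by (simp add: abs_mult powr_mult algebra_simps)
    moreover have "(s * u - s * y)\<^sup>2 = s\<^sup>2 * (u - y)\<^sup>2"
      by (simp add: power2_eq_square algebra_simps)
    ultimately show ?thesis
      by (simp add: lp_objective_def distrib_left)
  qed
  have "lp_min p (s powr (2 - p) * lam) (s * u) (s * x) \<longleftrightarrow>
      (\<forall>y. lp_objective p (s powr (2 - p) * lam) (s * u) (s * x)
         \<le> lp_objective p (s powr (2 - p) * lam) (s * u) (s * y))"
    unfolding lp_min_def using assms
    by (metis mult.commute nonzero_divide_eq_eq less_irrefl)
  also have "\<dots> \<longleftrightarrow> lp_min p lam u x"
    unfolding eq lp_min_def using assms by simp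
  finally show ?thesis .
qed

text \<open>A linear bijection between two sets of minimizers preserves uniqueness and fixes the tie
  value 0, so it commutes with \<open>eta\<close>. Reflection (\<open>c = - 1\<close>) and scaling
  (\<open>c = s\<close>) are the two instances.\<close>

lemma eta_transport:
  assumes "c \<noteq> 0" and eq: "\<And>x. lp_min p lam' u' (c * x) \<longleftrightarrow> lp_min p lam u x"
  shows "eta p u' lam' = c * eta p u lam"
proof -
  have eq': "lp_min p lam' u' y \<longleftrightarrow> lp_min p lam u (y / c)" for y
    using eq[of "y / c"] assms(1) by simp
  show ?thesis
  proof (cases "\<exists>!x. lp_min p lam u x")
    case True
    then obtain x where x: "lp_min p lam u x" "\<And>y. lp_min p lam u y \<Longrightarrow> y = x"
      by auto
    have x'': "lp_min p lam u y \<longleftrightarrow> y = x" for y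
      using x by blast
    have x': "lp_min p lam' u' y \<longleftrightarrow> y = c * x" for y
      unfolding eq' x'' using assms(1) by (simp add: divide_eq_eq mult.commute)
    show ?thesis
      unfolding eta_lp_min x' x'' by simp
  next
    case False
    moreover have "\<not> (\<exists>!x. lp_min p lam' u' x)"
    proof
      assume "\<exists>!x. lp_min p lam' u' x"
      then obtain x where x: "lp_min p lam' u' x" "\<And>y. lp_min p lam' u' y \<Longrightarrow> y = x"
        by blast
      have "y = x / c" if "lp_min p lam u y" for y
        using x(2)[of "c * y"] that assms(1) by (simp add: eq field_simps)
      moreover have "lp_min p lam u (x / c)"
        using x(1) by (simp only: eq')
      ultimately show False
        using False by blast
    qed
    ultimately show ?thesis
      by (simp add: eta_lp_min)
  qed
qed

lemma eta_minus: "eta p (- u) lam = - eta p u lam"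
  using eta_transport[of "-1" p lam "- u" lam u] by (simp add: lp_min_minus)

lemma eta_scale:
  assumes "0 < s"
  shows "eta p (s * u) (s powr (2 - p) * lam) = s * eta p u lam"
  using assms by (intro eta_transport) (auto simp: lp_min_scale)

section \<open>Existence, location and uniqueness of minimizers\<close>

context
  fixes p lam :: real
  assumes p: "0 \<le> p" "p \<le> 1" and lam: "0 \<le> lam"
begin

lemma lp_min_exists: "\<exists>x. lp_min p lam u x"
\<comment> \<open>For \<open>p = 0\<close> the penalty jumps at 0, so the cheaper of the two
  candidates 0 and \<open>u\<close> is exhibited directly; for \<open>p > 0\<close> continuity and
  compactness apply.\<close>
proof (cases "p = 0")
  case True
  show ?thesis
  proof (cases "lp_objective p lam u 0 \<le> lp_objective p lam u u")
    case True
    then have "lp_min p lam u 0"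
      using \<open>p = 0\<close> unfolding lp_min_def lp_objective_def
      using lam by (auto split: if_splits intro: add_increasing add_nonneg_nonneg)
    then show ?thesis ..
  next
    case False
    then have "lp_min p lam u u"
      using \<open>p = 0\<close> unfolding lp_min_def lp_objective_def
      by (auto split: if_splits)
    then show ?thesis ..
  qed
next
  case False
  with p have "0 < p" by simp
  \<comment> \<open>Outside this interval \<open>y\<close> is at least as far from \<open>u\<close>
    as 0 is and pays a nonnegative penalty, so 0, which lies in \<open>A\<close>, does no
    worse.\<close>
  define A where "A = {- 2 * \<bar>u\<bar> .. 2 * \<bar>u\<bar>}"
  have "continuous_on A (\<lambda>x. lp_objective p lam u x)"
    unfolding lp_objective_def using \<open>0 < p\<close>
    by (intro continuous_intros continuous_on_powr') auto
  moreover have "compact A" "A \<noteq> {}"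
    by (auto simp: A_def)
  ultimately obtain x where x: "x \<in> A" "\<And>y. y \<in> A \<Longrightarrow> lp_objective p lam u x \<le> lp_objective p lam u y"
    using continuous_attains_inf[of A "lp_objective p lam u"] by auto
  have "lp_objective p lam u x \<le> lp_objective p lam u y" for y
  proof (cases "y \<in> A")
    case False
    then have "2 * \<bar>u\<bar> \<le> \<bar>y\<bar>"
      by (auto simp: A_def)
    then have "u\<^sup>2 \<le> (u - y)\<^sup>2"
      by (intro abs_le_square_iff[THEN iffD1]) auto
    moreover have "0 \<le> lam * \<bar>y\<bar> powr p"
      using lam by simp
    ultimately have "lp_objective p lam u 0 \<le> lp_objective p lam u y"
      unfolding lp_objective_def by simp
    moreover have "0 \<in> A" by (auto simp: A_def)
    ultimately show ?thesis
      using x(2) by fastforce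
  qed (use x in auto)
  then show ?thesis
    by (auto simp: lp_min_def)
qed

text \<open>A point beyond \<open>u\<close> loses strictly to \<open>u\<close>, and a negative point
  loses strictly to 0: the quadratic term is larger and the penalty is no smaller.\<close>

lemma lp_min_between:
  assumes x: "lp_min p lam u x" and u: "0 \<le> u"
  shows "0 \<le> x" "x \<le> u"
proof -
  show "x \<le> u"
  proof (rule ccontr)
    assume "\<not> x \<le> u"
    then have "\<bar>u\<bar> powr p \<le> \<bar>x\<bar> powr p"
      using p u by (intro powr_mono2) auto
    then have "lam * \<bar>u\<bar> powr p \<le> lam * \<bar>x\<bar> powr p"
      using lam by (rule mult_left_mono)
    moreover have "0 < (u - x)\<^sup>2"
      using \<open>\<not> x \<le> u\<close> by simp
    moreover have "(u - u)\<^sup>2 = 0"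
      by simp
    ultimately have "lp_objective p lam u u < lp_objective p lam u x"
      unfolding lp_objective_def by linarith
    with x show False
      unfolding lp_min_def using not_le by blast
  qed
  show "0 \<le> x"
  proof (rule ccontr)
    assume "\<not> 0 \<le> x"
    have "u\<^sup>2 < (u - x)\<^sup>2"
      using \<open>\<not> 0 \<le> x\<close> u by (intro power_strict_mono) auto
    moreover have "0 \<le> lam * \<bar>x\<bar> powr p"
      using lam by simp
    ultimately have "lp_objective p lam u 0 < lp_objective p lam u x"
      unfolding lp_objective_def by simp
    with x show False
      unfolding lp_min_def using not_le by blast
  qed
qed

lemma DERIV_lp_objective:
  assumes "0 < x"
  shows "(lp_objective p lam u has_real_derivative x - u + lam * (p * x powr (p - 1))) (at x)"
proof -
  have "((\<lambda>y. (u - y)\<^sup>2 / 2 + lam * y powr p) has_real_derivative x - u + lam * (p * x powr (p - 1))) (at x)"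
    using assms by (auto intro!: derivative_eq_intros)
  moreover have "\<forall>\<^sub>F y in nhds x. (u - y)\<^sup>2 / 2 + lam * y powr p = lp_objective p lam u y"
    by (rule eventually_mono[OF eventually_nhds_in_open[of "{0<..}" x]])
      (use assms in \<open>auto simp: lp_objective_def\<close>)
  ultimately show ?thesis
    by (subst DERIV_cong_ev[OF refl _ refl, symmetric])
qed

lemma lp_min_stationary:
  assumes "lp_min p lam u x" "0 < x"
  shows "u = x + lam * (p * x powr (p - 1))"
proof -
  have "x - u + lam * (p * x powr (p - 1)) = 0"
    using DERIV_lp_objective[OF assms(2)] zero_less_one
    by (rule DERIV_local_min) (use assms(1) in \<open>auto simp: lp_min_def\<close>)
  then show ?thesis by simp
qed

text \<open>Two positive minimizers are two zeros of the derivative of the objective with a third one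
  between them by Rolle, so the second derivative \<open>1 + lam * p * (p - 1) * x powr (p - 2)\<close> would
  vanish twice, although it is injective unless it is constantly \<open>1\<close>.\<close>

lemma lp_min_pos_unique_less:
  assumes x: "lp_min p lam u x" "0 < x" and y: "lp_min p lam u y" and "x < y"
  shows False
proof -
  define g where "g = (\<lambda>x. x - u + lam * (p * x powr (p - 1)))"
  define g' where "g' = (\<lambda>x. 1 + lam * (p * ((p - 1) * x powr (p - 2))))"
  have g': "(g has_real_derivative g' z) (at z)" if "0 < z" for z
  proof -
    have "p - 1 - 1 = p - 2" by simp
    then show ?thesis
      unfolding g_def g'_def using that by (auto intro!: derivative_eq_intros)
  qed
  have f: "lp_objective p lam u x = lp_objective p lam u y"
    using x y by (auto simp: lp_min_def intro: antisym)
  have gx: "g x = 0" and gy: "g y = 0"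
    using lp_min_stationary[OF x] lp_min_stationary[OF y] x(2) \<open>x < y\<close> by (auto simp: g_def)
  have df: "(lp_objective p lam u has_real_derivative g z) (at z)" if "0 < z" for z
    unfolding g_def by (rule DERIV_lp_objective[OF that])
  have rolle: "\<exists>c. a < c \<and> c < b \<and> h' c = 0"
    if "0 < a" "a < b" "h a = h b" "\<And>z. 0 < z \<Longrightarrow> (h has_real_derivative h' z) (at z)"
    for a b and h h' :: "real \<Rightarrow> real"
  proof -
    have "continuous_on {a..b} h"
      by (rule DERIV_continuous_on[where D = h'])
        (use that in \<open>auto intro: has_field_derivative_at_within\<close>)
    moreover have "h differentiable at z" if z: "a < z" for z
      using z \<open>0 < a\<close> \<open>\<And>z. 0 < z \<Longrightarrow> (h has_real_derivative h' z) (at z)\<close>[of z]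
      by (auto simp: real_differentiable_def)
    ultimately obtain c where "a < c" "c < b" "DERIV h c :> 0"
      using Rolle[of a b h] \<open>a < b\<close> \<open>h a = h b\<close> by metis
    then show ?thesis
      using DERIV_unique[of h 0 c "h' c"] that(1) that(4)[of c] by (intro exI[of _ c]) auto
  qed
  obtain z where z: "x < z" "z < y" "g z = 0"
    using rolle[OF x(2) \<open>x < y\<close> f df] by auto
  obtain c where c: "x < c" "c < z" "g' c = 0"
    using rolle[of x z g g'] g' gx z x by auto
  obtain d where d: "z < d" "d < y" "g' d = 0"
    using rolle[of z y g g'] g' gy z x by auto
  have "lam * p * (p - 1) * c powr (p - 2) = - 1" "lam * p * (p - 1) * d powr (p - 2) = - 1"
    using c(3) d(3) by (simp_all add: g'_def mult.assoc)
  \<comment> \<open>Both products equal -1, so their common factor \<open>lam * p * (p - 1)\<close>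
    is nonzero and cancels.\<close>
  then have "c powr (p - 2) = d powr (p - 2)"
    by (metis mult_cancel_left mult_zero_left zero_neq_neg_one)
  moreover have "d powr (p - 2) < c powr (p - 2)"
    using p c d x(2) by (intro powr_less_mono2_neg) auto
  ultimately show False by simp
qed

text \<open>Ties can only occur between \<open>0\<close> and a single nonzero point, so the tie-breaking value
  \<open>0\<close> is a minimizer as well.\<close>

lemma lp_min_eta: "lp_min p lam u (eta p u lam)"
proof -
  have nonneg: "lp_min p lam u (eta p u lam)" if "0 \<le> u" for u
  proof (cases "\<exists>!x. lp_min p lam u x")
    case True
    then show ?thesis
      using theI'[OF True] by (simp add: eta_lp_min)
  next
    case False
    then obtain x y where xy: "lp_min p lam u x" "lp_min p lam u y" "x < y"
      using lp_min_exists[of u] by (metis linorder_neqE_linordered_idom)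
    have "x = 0"
      using lp_min_pos_unique_less[OF xy(1) _ xy(2,3)] lp_min_between(1)[OF xy(1) that] by fastforce
    then show ?thesis
      using xy False by (simp add: eta_lp_min)
  qed
  show ?thesis
  proof (cases "0 \<le> u")
    case False
    then have "lp_min p lam (- u) (eta p (- u) lam)"
      by (intro nonneg) auto
    then show ?thesis
      by (simp add: eta_minus lp_min_minus)
  qed (rule nonneg)
qed

section \<open>Size, monotonicity and expansion of the thresholding map\<close>

lemma eta_between:
  assumes "0 \<le> u"
  shows "0 \<le> eta p u lam" "eta p u lam \<le> u"
  using lp_min_between[OF lp_min_eta assms] by auto

lemma abs_eta_le: "\<bar>eta p u lam\<bar> \<le> \<bar>u\<bar>"
  using eta_between[of u] eta_between[of "- u"] by (cases "0 \<le> u") (auto simp: eta_minus)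

text \<open>Exchange argument: adding the two optimality inequalities cancels the penalties and
  leaves \<open>0 \<le> (v - u) * (y - x)\<close>. Since \<open>eta\<close> may jump, its Borel
  measurability is also drawn from here.\<close>

lemma mono_eta: "mono (\<lambda>u. eta p u lam)"
proof (rule monoI)
  fix u v :: real assume "u \<le> v"
  define x y where "x = eta p u lam" and "y = eta p v lam"
  show "x \<le> y"
  proof (cases "u = v")
    case False
    have "lp_objective p lam u x \<le> lp_objective p lam u y" "lp_objective p lam v y \<le> lp_objective p lam v x"
      using lp_min_eta by (auto simp: lp_min_def x_def y_def)
    then have "(u - x)\<^sup>2 + (v - y)\<^sup>2 \<le> (u - y)\<^sup>2 + (v - x)\<^sup>2"
      unfolding lp_objective_def by argo
    then have "0 \<le> (v - u) * (y - x)"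
      by (simp add: power2_eq_square algebra_simps)
    then show ?thesis
      using False \<open>u \<le> v\<close> by (simp add: zero_le_mult_iff)
  qed (simp add: x_def y_def)
qed

lemma borel_measurable_eta [measurable]: "(\<lambda>u. eta p u lam) \<in> borel_measurable borel"
  by (rule borel_measurable_mono[OF mono_eta])

text \<open>Against the competitor \<open>u\<close>, a displacement \<open>d\<close> satisfies
  \<open>d\<^sup>2 / 2 \<le> lam * (u powr p - x powr p)\<close>, and subadditivity bounds the
  difference of powers by \<open>d powr p\<close>. For \<open>d \<ge> 1\<close> this is at most
  \<open>d\<close>, whence \<open>d \<le> 2 * lam\<close>; the summand 1 covers smaller
  displacements.\<close>

lemma abs_eta_diff_le: "\<bar>eta p u lam - u\<bar> \<le> 1 + 2 * lam"
proof -
  \<comment> \<open>The shares of \<open>a\<close> and \<open>b\<close> in \<open>a + b\<close> lie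
    in the unit interval, so raising them to the power \<open>p\<close> does not decrease them, and
    they add up to 1.\<close>
  have subadd: "(a + b) powr p \<le> a powr p + b powr p" if "0 < a" "0 < b" for a b :: real
  proof -
    have le: "x / (a + b) \<le> (x / (a + b)) powr p" if "x \<in> {a, b}" for x
      using powr_mono'[of p 1 "x / (a + b)"] p \<open>0 < a\<close> \<open>0 < b\<close> that by auto
    have "1 = a / (a + b) + b / (a + b)"
      using that by (simp flip: add_divide_distrib)
    also have "\<dots> \<le> (a / (a + b)) powr p + (b / (a + b)) powr p"
      using le by (intro add_mono) auto
    also have "\<dots> = (a powr p + b powr p) / (a + b) powr p"
      using that by (simp add: powr_divide add_divide_distrib)
    finally show ?thesis
      using that by (simp add: field_simps)
  qed
  have nonneg: "\<bar>eta p u lam - u\<bar> \<le> 1 + 2 * lam" if "0 \<le> u" for u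
  proof (rule ccontr)
    assume *: "\<not> ?thesis"
    define x d where "x = eta p u lam" and "d = u - x"
    have x: "0 \<le> x" "x \<le> u"
      using eta_between[OF that] by (auto simp: x_def)
    have d: "1 + 2 * lam < d"
      using * x by (auto simp: d_def x_def)
    have u: "u = x + d" by (simp add: d_def)
    have "u powr p \<le> x powr p + d powr p"
      using subadd[of x d] x d lam unfolding u by (cases "x = 0") auto
    also have "d powr p \<le> d powr 1"
      using d lam p by (intro powr_mono) auto
    finally have pw: "u powr p - x powr p \<le> d"
      using d lam by simp
    have "lp_objective p lam u x \<le> lp_objective p lam u u"
      using lp_min_eta by (auto simp: lp_min_def x_def)
    then have "d\<^sup>2 / 2 \<le> lam * (u powr p - x powr p)"
      using x that unfolding lp_objective_def d_def by (simp add: algebra_simps)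
    also have "\<dots> \<le> lam * d"
      using pw lam by (rule mult_left_mono)
    finally have "d * d \<le> (2 * lam) * d"
      by (simp add: power2_eq_square)
    then show False
      using d lam by (simp add: mult_le_cancel_right)
  qed
  show ?thesis
    using nonneg[of u] nonneg[of "- u"] by (cases "0 \<le> u") (auto simp: eta_minus)
qed

text \<open>The penalty is concave on the positive half-line, so the correction \<open>u - eta p u lam\<close>, which
  is its derivative at the minimizer, decreases.\<close>

lemma eta_expanding:
  assumes "0 < u" "u \<le> v" "eta p u lam \<noteq> 0"
  shows "v - u \<le> eta p v lam - eta p u lam"
proof -
  define x y where "x = eta p u lam" and "y = eta p v lam"
  have "x \<le> y"
    using mono_eta \<open>u \<le> v\<close> by (auto simp: x_def y_def mono_def)
  have "0 < x"
    using eta_between(1)[of u] assms by (auto simp: x_def)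
  have "u = x + lam * (p * x powr (p - 1))" "v = y + lam * (p * y powr (p - 1))"
    using lp_min_stationary lp_min_eta \<open>0 < x\<close> \<open>x \<le> y\<close> by (auto simp: x_def y_def)
  moreover have "lam * (p * y powr (p - 1)) \<le> lam * (p * x powr (p - 1))"
    using p lam \<open>0 < x\<close> \<open>x \<le> y\<close>
    by (intro mult_left_mono powr_mono2') auto
  ultimately show ?thesis
    unfolding x_def y_def by linarith
qed

text \<open>For \<open>x > 0\<close> and \<open>w \<ge> 0\<close> there are two cases. If
  \<open>x - w\<close> is sent to 0, the error \<open>x\<^sup>2\<close> alone is at least
  \<open>4 * w\<^sup>2\<close>. Otherwise expansion separates the two signed errors \<open>a\<close>
  and \<open>b\<close> by at least \<open>2 * w\<close>, and
  \<open>(a - b)\<^sup>2 \<le> 2 * (a\<^sup>2 + b\<^sup>2)\<close>. The other signs follow by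
  symmetry.\<close>

lemma eta_symmetrized_error:
  assumes "2 * \<bar>w\<bar> \<le> \<bar>x\<bar>"
  shows "2 * w\<^sup>2 \<le> (eta p (x + w) lam - x)\<^sup>2 + (eta p (x - w) lam - x)\<^sup>2"
proof -
  have pos: "2 * w\<^sup>2 \<le> (eta p (x + w) lam - x)\<^sup>2 + (eta p (x - w) lam - x)\<^sup>2"
    if "0 \<le> w" "2 * w \<le> x" "0 < x" for x w
  proof (cases "eta p (x - w) lam = 0")
    case True
    have "(2 * w)\<^sup>2 \<le> x\<^sup>2"
      using that by (intro power_mono) auto
    moreover have "0 \<le> w\<^sup>2" "(2 * w)\<^sup>2 = 4 * w\<^sup>2"
      by (auto simp: power_mult_distrib)
    ultimately have "2 * w\<^sup>2 \<le> x\<^sup>2"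
      by linarith
    then show ?thesis
      using True by (simp add: add_increasing)
  next
    case False
    define a b where "a = eta p (x + w) lam - x" and "b = eta p (x - w) lam - x"
    have "2 * w \<le> a - b"
      using eta_expanding[of "x - w" "x + w"] False that by (simp add: a_def b_def)
    then have "(2 * w)\<^sup>2 \<le> (a - b)\<^sup>2"
      using that by (intro power_mono) auto
    also have "\<dots> \<le> 2 * (a\<^sup>2 + b\<^sup>2)"
      using zero_le_power2[of "a + b"] by (simp add: power2_eq_square algebra_simps)
    finally show ?thesis
      by (simp add: a_def b_def power_mult_distrib)
  qed
  have sgn: "2 * w\<^sup>2 \<le> (eta p (x + w) lam - x)\<^sup>2 + (eta p (x - w) lam - x)\<^sup>2"
    if "2 * \<bar>w\<bar> \<le> x" "0 < x" for x w
    using pos[of w x] pos[of "- w" x] that by (cases "0 \<le> w") auto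
  consider "0 < x" | "x = 0" | "x < 0" by linarith
  then show ?thesis
  proof cases
    case 3
    have "eta p (- x + w) lam = - eta p (x - w) lam" "eta p (- x - w) lam = - eta p (x + w) lam"
      using eta_minus[of p "x - w" lam] eta_minus[of p "x + w" lam]
      by (simp_all add: minus_diff_commute)
    then show ?thesis
      using sgn[of w "- x"] 3 assms by (simp add: power2_eq_square algebra_simps)
  qed (use sgn[of w x] assms in auto)
qed

end

text \<open>Every nonzero point pays exactly \<open>lam\<close> in penalty, so a nonzero minimizer
  can only be \<open>u\<close> itself, and comparison with 0 decides between the two.\<close>

lemma eta_0:
  assumes "0 < lam"
  shows "eta 0 u lam = u \<or> eta 0 u lam = 0 \<and> u\<^sup>2 \<le> 2 * lam"
    and "u\<^sup>2 < 2 * lam \<Longrightarrow> eta 0 u lam = 0"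
proof -
  define x where "x = eta 0 u lam"
  have "lp_objective 0 lam u x \<le> lp_objective 0 lam u y" for y
    using lp_min_eta[of 0 lam u] assms by (auto simp: lp_min_def x_def)
  from this[of 0] this[of u]
  have *: "lp_objective 0 lam u x \<le> u\<^sup>2 / 2" "lp_objective 0 lam u x \<le> lam"
    using assms by (auto simp: lp_objective_def[of _ _ _ 0] lp_objective_def[of _ _ _ u] split: if_splits)
  show "eta 0 u lam = u \<or> eta 0 u lam = 0 \<and> u\<^sup>2 \<le> 2 * lam"
    using * unfolding x_def[symmetric] by (cases "x = 0") (auto simp: lp_objective_def)
  show "eta 0 u lam = 0" if "u\<^sup>2 < 2 * lam"
  proof (rule ccontr)
    assume "\<not> ?thesis"
    then have "lam \<le> lp_objective 0 lam u x"
      by (auto simp: lp_objective_def x_def)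
    with * that show False by simp
  qed
qed

section \<open>Gaussian risk and the minimax bound\<close>

lemma std_normal_second_moment:
  "integrable std_normal_distribution (\<lambda>z. z\<^sup>2)" "(\<integral>z. z\<^sup>2 \<partial>std_normal_distribution) = 1"
  using std_normal_distribution_even_moments[of 1] by (simp_all add: fact_numeral)

lemma nn_integral_std_normal_dilation_le:
  fixes f :: "real \<Rightarrow> ennreal"
  assumes [measurable]: "f \<in> borel_measurable borel" and c: "1 \<le> \<bar>c\<bar>"
  shows "(\<integral>\<^sup>+z. f z \<partial>std_normal_distribution) \<le> ennreal \<bar>c\<bar> * (\<integral>\<^sup>+z. f (c * z) \<partial>std_normal_distribution)"
proof -
  have le: "std_normal_density (c * z) \<le> std_normal_density z" for z
  proof -
    have "z\<^sup>2 \<le> (c * z)\<^sup>2"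
      using c mult_right_mono[of 1 "\<bar>c\<bar>" "\<bar>z\<bar>"]
      by (intro abs_le_square_iff[THEN iffD1]) (auto simp: abs_mult)
    then show ?thesis
      unfolding std_normal_density_def by (intro mult_left_mono) auto
  qed
  have "(\<integral>\<^sup>+z. f z \<partial>std_normal_distribution)
      = ennreal \<bar>c\<bar> * (\<integral>\<^sup>+z. ennreal (std_normal_density (c * z)) * f (c * z) \<partial>lborel)"
    using c nn_integral_real_affine[of "\<lambda>z. ennreal (std_normal_density z) * f z" c 0]
    by (subst nn_integral_density) auto
  also have "\<dots> \<le> ennreal \<bar>c\<bar> * (\<integral>\<^sup>+z. ennreal (std_normal_density z) * f (c * z) \<partial>lborel)"
    by (intro mult_left_mono nn_integral_mono mult_right_mono ennreal_leI le) auto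
  also have "\<dots> = ennreal \<bar>c\<bar> * (\<integral>\<^sup>+z. f (c * z) \<partial>std_normal_distribution)"
    by (subst nn_integral_density) auto
  finally show ?thesis .
qed

lemma square_sum_le: "(a + b)\<^sup>2 \<le> 2 * a\<^sup>2 + 2 * (b :: real)\<^sup>2"
  using zero_le_power2[of "a - b"] by (simp add: power2_eq_square algebra_simps)

text \<open>An integrable majorant that is independent of \<open>p\<close> and \<open>lam\<close>,
  from \<open>abs_eta_le\<close> and the triangle inequality.\<close>

lemma square_eta_error_le:
  assumes "0 \<le> p" "p \<le> 1" "0 \<le> lam"
  shows "(eta p (x + w) lam - x)\<^sup>2 \<le> 8 * x\<^sup>2 + 2 * w\<^sup>2"
proof -
  have "\<bar>eta p (x + w) lam - x\<bar> \<le> \<bar>2 * \<bar>x\<bar> + \<bar>w\<bar>\<bar>"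
    using abs_eta_le[OF assms, of "x + w"] by linarith
  then have "(eta p (x + w) lam - x)\<^sup>2 \<le> (2 * \<bar>x\<bar> + \<bar>w\<bar>)\<^sup>2"
    by (simp only: abs_le_square_iff)
  also have "\<dots> \<le> 8 * x\<^sup>2 + 2 * w\<^sup>2"
    using square_sum_le[of "2 * \<bar>x\<bar>" "\<bar>w\<bar>"] by (simp add: power_mult_distrib)
  finally show ?thesis .
qed

definition gauss_risk :: "real \<Rightarrow> real \<Rightarrow> real \<Rightarrow> real" where
  "gauss_risk p tau mu = (\<integral>z. (eta p (mu + z) tau - mu)\<^sup>2 \<partial>std_normal_distribution)"

context
  fixes p tau :: real
  assumes p: "0 \<le> p" "p \<le> 1" and tau: "0 \<le> tau"
begin

lemma integrable_gauss_risk: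
  "integrable std_normal_distribution (\<lambda>z. (eta p (mu + z) tau - mu)\<^sup>2)"
proof (rule Bochner_Integration.integrable_bound)
  interpret prob_space std_normal_distribution
    by (rule prob_space_normal_density) simp
  show "integrable std_normal_distribution (\<lambda>z. 8 * mu\<^sup>2 + 2 * z\<^sup>2)"
    using std_normal_second_moment(1) by auto
  have "(\<lambda>z. eta p (mu + z) tau) \<in> borel_measurable borel"
    using borel_measurable_eta[OF p tau] by measurable
  then show "(\<lambda>z. (eta p (mu + z) tau - mu)\<^sup>2) \<in> borel_measurable std_normal_distribution"
    by measurable
  show "AE z in std_normal_distribution. norm ((eta p (mu + z) tau - mu)\<^sup>2) \<le> norm (8 * mu\<^sup>2 + 2 * z\<^sup>2)"
    using square_eta_error_le[OF p tau, of mu] by (intro always_eventually) fastforce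
qed

lemma gauss_risk_nonneg: "0 \<le> gauss_risk p tau mu"
  by (simp add: gauss_risk_def)

text \<open>The error splits into the displacement of \<open>eta\<close>, bounded by
  \<open>abs_eta_diff_le\<close>, and the noise \<open>z\<close>. Uniformity in \<open>mu\<close>
  makes the supremum in \<open>Mbar\<close> a genuine one.\<close>

lemma gauss_risk_bounded: "gauss_risk p tau mu \<le> 2 * (1 + 2 * tau)\<^sup>2 + 2"
proof -
  interpret prob_space std_normal_distribution
    by (rule prob_space_normal_density) simp
  have "gauss_risk p tau mu \<le> (\<integral>z. 2 * (1 + 2 * tau)\<^sup>2 + 2 * z\<^sup>2 \<partial>std_normal_distribution)"
    unfolding gauss_risk_def
  proof (rule integral_mono)
    fix z :: real
    have "(eta p (mu + z) tau - mu)\<^sup>2 \<le> 2 * (eta p (mu + z) tau - (mu + z))\<^sup>2 + 2 * z\<^sup>2"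
      using square_sum_le[of "eta p (mu + z) tau - (mu + z)" z] by simp
    moreover have "(eta p (mu + z) tau - (mu + z))\<^sup>2 \<le> (1 + 2 * tau)\<^sup>2"
      using abs_eta_diff_le[OF p tau, of "mu + z"] tau
      by (intro abs_le_square_iff[THEN iffD1]) auto
    ultimately show "(eta p (mu + z) tau - mu)\<^sup>2 \<le> 2 * (1 + 2 * tau)\<^sup>2 + 2 * z\<^sup>2"
      by linarith
  qed (use integrable_gauss_risk std_normal_second_moment(1) in auto)
  also have "\<dots> = 2 * (1 + 2 * tau)\<^sup>2 + 2"
    using std_normal_second_moment prob_space by (subst Bochner_Integration.integral_add) auto
  finally show ?thesis .
qed

lemma nn_integral_gauss_risk:
  "(\<integral>\<^sup>+z. ennreal ((eta p (mu + z) tau - mu)\<^sup>2) \<partial>std_normal_distribution) = ennreal (gauss_risk p tau mu)"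
  unfolding gauss_risk_def by (rule nn_integral_eq_integral[OF integrable_gauss_risk]) simp

text \<open>\<open>eta\<close> is odd and the Gaussian symmetric. This extends the supremum over
  \<open>mu \<ge> 0\<close> in \<open>Mbar\<close> to signals of either sign.\<close>

lemma gauss_risk_minus: "gauss_risk p tau (- mu) = gauss_risk p tau mu"
proof -
  have le: "gauss_risk p tau (- mu) \<le> gauss_risk p tau mu" for mu
  proof -
    have meas: "(\<lambda>z. eta p (- mu + z) tau) \<in> borel_measurable borel"
      using borel_measurable_eta[OF p tau] by measurable
    have eq: "(eta p (- mu + - 1 * z) tau - - mu)\<^sup>2 = (eta p (mu + z) tau - mu)\<^sup>2" for z
      using eta_minus[of p "mu + z" tau] by (simp add: power2_commute)
    have "ennreal (gauss_risk p tau (- mu))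
        \<le> ennreal \<bar>- 1\<bar> * (\<integral>\<^sup>+z. ennreal ((eta p (- mu + - 1 * z) tau - - mu)\<^sup>2) \<partial>std_normal_distribution)"
      unfolding nn_integral_gauss_risk[symmetric]
      using meas by (intro nn_integral_std_normal_dilation_le
          [where c = "- 1" and f = "\<lambda>z. ennreal ((eta p (- mu + z) tau - - mu)\<^sup>2)"]) auto
    also have "\<dots> = ennreal (gauss_risk p tau mu)"
      by (simp only: eq nn_integral_gauss_risk) simp
    finally show ?thesis
      by (simp add: gauss_risk_nonneg)
  qed
  show ?thesis
    using le[of mu] le[of "- mu"] by simp
qed

end

lemma Mbar_gauss_risk:
  "Mbar p \<epsilon> = (INF tau \<in> {0..}. SUP mu \<in> {0..}. (1 - \<epsilon>) * gauss_risk p tau 0 + \<epsilon> * gauss_risk p tau mu)"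
  by (simp add: Mbar_def gauss_risk_def)

text \<open>The strict inequality passes through both infima to a particular \<open>p\<close> and
  \<open>tau\<close>. The bound \<open>b\<close> for nonzero signals is separated from the risk at
  0, so that the two can be weighted by the law of the signal.\<close>

lemma minimax_witness:
  assumes "(INF p \<in> {0..1}. Mbar p \<epsilon>) < \<delta>" and \<epsilon>: "0 \<le> \<epsilon>"
  obtains p tau b D where "0 \<le> p" "p \<le> 1" "0 \<le> tau" "\<And>mu. gauss_risk p tau mu \<le> b"
    "(1 - \<epsilon>) * gauss_risk p tau 0 + \<epsilon> * b \<le> D" "D < \<delta>"
proof -
  have "\<exists>p\<in>{0..1}. Mbar p \<epsilon> < \<delta>"
    using assms(1) cINF_greatest[of "{0..1::real}" \<delta> "\<lambda>p. Mbar p \<epsilon>"] by force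
  then obtain p where p: "0 \<le> p" "p \<le> 1" "Mbar p \<epsilon> < \<delta>"
    by auto
  define risk' where "risk' tau mu = (1 - \<epsilon>) * gauss_risk p tau 0 + \<epsilon> * gauss_risk p tau mu" for tau mu
  have "\<exists>tau\<in>{0..}. (SUP mu\<in>{0..}. risk' tau mu) < \<delta>"
    using p(3) cINF_greatest[of "{0::real..}" \<delta> "\<lambda>tau. SUP mu\<in>{0..}. risk' tau mu"]
    unfolding Mbar_gauss_risk risk'_def by force
  then obtain tau where tau: "0 \<le> tau" "(SUP mu\<in>{0..}. risk' tau mu) < \<delta>"
    by auto
  define D where "D = (SUP mu\<in>{0..}. risk' tau mu)"
  have "bdd_above (risk' tau ` {0..})"
    using gauss_risk_bounded[OF p(1,2) tau(1)] \<epsilon>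
    by (intro bdd_aboveI2[where M = "(1 - \<epsilon>) * gauss_risk p tau 0 + \<epsilon> * (2 * (1 + 2 * tau)\<^sup>2 + 2)"])
      (auto simp: risk'_def intro!: mult_left_mono)
  then have D: "risk' tau mu \<le> D" if "0 \<le> mu" for mu
    using that unfolding D_def by (intro cSUP_upper) auto
  have abs: "gauss_risk p tau \<bar>mu\<bar> = gauss_risk p tau mu" for mu
    using gauss_risk_minus[OF p(1,2) tau(1), of mu] by (cases "0 \<le> mu") auto
  have D': "risk' tau mu \<le> D" for mu
    using D[of "\<bar>mu\<bar>"] unfolding risk'_def abs by simp
  \<comment> \<open>For \<open>\<epsilon> \<noteq> 0\<close> this solves
    \<open>(1 - \<epsilon>) * gauss_risk p tau 0 + \<epsilon> * b = D\<close>. For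
    \<open>\<epsilon> = 0\<close> the weight of \<open>b\<close> vanishes and the uniform risk bound
    serves.\<close>
  define b where "b = (if \<epsilon> = 0 then 2 * (1 + 2 * tau)\<^sup>2 + 2 else (D - (1 - \<epsilon>) * gauss_risk p tau 0) / \<epsilon>)"
  have "gauss_risk p tau mu \<le> b" for mu
    using D'[of mu] gauss_risk_bounded[OF p(1,2) tau(1), of mu] \<epsilon>
    by (auto simp: b_def risk'_def field_simps)
  moreover have "(1 - \<epsilon>) * gauss_risk p tau 0 + \<epsilon> * b \<le> D"
    using D'[of 0] by (auto simp: b_def risk'_def)
  ultimately show ?thesis
    using that p tau D_def by blast
qed

section \<open>Risk of a noisy signal\<close>

locale noisy_signal = prob_space +
  fixes X Z :: "'a \<Rightarrow> real"
  assumes integrable_square_X: "integrable M (\<lambda>\<omega>. (X \<omega>)\<^sup>2)"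
    and distributed_Z: "distributed M lborel Z std_normal_density"
    and indep_X_Z: "indep_var borel X borel Z"
begin

lemma measurable_X [measurable]: "X \<in> borel_measurable M"
  and measurable_Z [measurable]: "Z \<in> borel_measurable M"
  using indep_var_rv1[OF indep_X_Z] indep_var_rv2[OF indep_X_Z] by auto

lemma distr_Z: "distr M borel Z = std_normal_distribution"
  using distributed_distr_eq_density[OF distributed_Z] by (simp cong: distr_cong)

lemma distr_X_Z: "distr M (borel \<Otimes>\<^sub>M borel) (\<lambda>\<omega>. (X \<omega>, Z \<omega>)) = distr M borel X \<Otimes>\<^sub>M std_normal_distribution"
  using indep_X_Z distr_Z by (simp add: indep_var_distribution_eq)

lemma square_Z: "integrable M (\<lambda>\<omega>. (Z \<omega>)\<^sup>2)" "expectation (\<lambda>\<omega>. (Z \<omega>)\<^sup>2) = 1"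
proof -
  have "integrable (distr M borel Z) (\<lambda>z. z\<^sup>2)" "(\<integral>z. z\<^sup>2 \<partial>distr M borel Z) = 1"
    unfolding distr_Z by (fact std_normal_second_moment)+
  then show "integrable M (\<lambda>\<omega>. (Z \<omega>)\<^sup>2)" "expectation (\<lambda>\<omega>. (Z \<omega>)\<^sup>2) = 1"
    by (simp_all add: integrable_distr_eq integral_distr)
qed

text \<open>Independence makes the joint law a product, and Tonelli then averages over the noise for
  a fixed signal value.\<close>

lemma nn_integral_X_Z:
  assumes [measurable]: "G \<in> borel_measurable (borel \<Otimes>\<^sub>M borel)"
  shows "(\<integral>\<^sup>+\<omega>. G (X \<omega>, Z \<omega>) \<partial>M) = (\<integral>\<^sup>+\<omega>. (\<integral>\<^sup>+z. G (X \<omega>, z) \<partial>std_normal_distribution) \<partial>M)"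
proof -
  interpret N: prob_space std_normal_distribution
    by (rule prob_space_normal_density) simp
  have "(\<integral>\<^sup>+\<omega>. G (X \<omega>, Z \<omega>) \<partial>M) = (\<integral>\<^sup>+u. G u \<partial>distr M (borel \<Otimes>\<^sub>M borel) (\<lambda>\<omega>. (X \<omega>, Z \<omega>)))"
    by (subst nn_integral_distr) auto
  also have "\<dots> = (\<integral>\<^sup>+x. (\<integral>\<^sup>+z. G (x, z) \<partial>std_normal_distribution) \<partial>distr M borel X)"
    unfolding distr_X_Z by (subst N.nn_integral_fst[symmetric]) auto
  also have "\<dots> = (\<integral>\<^sup>+\<omega>. (\<integral>\<^sup>+z. G (X \<omega>, z) \<partial>std_normal_distribution) \<partial>M)"
    by (subst nn_integral_distr) auto
  finally show ?thesis .
qed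

text \<open>The density comparison is applied to the noise with the signal frozen. It is used with
  \<open>c = \<sigma> / s\<close> to compare noise levels and with \<open>c = - 1\<close> to flip
  the noise.\<close>

lemma expectation_dilation_le:
  fixes F :: "real \<Rightarrow> real \<Rightarrow> real"
  assumes [measurable]: "case_prod F \<in> borel_measurable (borel \<Otimes>\<^sub>M borel)"
    and nonneg: "\<And>x z. 0 \<le> F x z" and c: "1 \<le> \<bar>c\<bar>"
    and int: "integrable M (\<lambda>\<omega>. F (X \<omega>) (Z \<omega>))" "integrable M (\<lambda>\<omega>. F (X \<omega>) (c * Z \<omega>))"
  shows "expectation (\<lambda>\<omega>. F (X \<omega>) (Z \<omega>)) \<le> \<bar>c\<bar> * expectation (\<lambda>\<omega>. F (X \<omega>) (c * Z \<omega>))"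
proof -
  interpret N: prob_space std_normal_distribution
    by (rule prob_space_normal_density) simp
  have "ennreal (expectation (\<lambda>\<omega>. F (X \<omega>) (Z \<omega>))) = (\<integral>\<^sup>+\<omega>. ennreal (case_prod F (X \<omega>, Z \<omega>)) \<partial>M)"
    using nn_integral_eq_integral[OF int(1)] nonneg by simp
  also have "\<dots> = (\<integral>\<^sup>+\<omega>. (\<integral>\<^sup>+z. ennreal (F (X \<omega>) z) \<partial>std_normal_distribution) \<partial>M)"
    by (subst nn_integral_X_Z) auto
  also have "\<dots> \<le> (\<integral>\<^sup>+\<omega>. ennreal \<bar>c\<bar> * (\<integral>\<^sup>+z. ennreal (F (X \<omega>) (c * z)) \<partial>std_normal_distribution) \<partial>M)"
    using c by (intro nn_integral_mono
        nn_integral_std_normal_dilation_le[where c = c and f = "\<lambda>z. ennreal (F (X _) z)"]) auto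
  also have "\<dots> = ennreal \<bar>c\<bar> * (\<integral>\<^sup>+\<omega>. (\<integral>\<^sup>+z. ennreal (F (X \<omega>) (c * z)) \<partial>std_normal_distribution) \<partial>M)"
    by (subst nn_integral_cmult) auto
  also have "\<dots> = ennreal \<bar>c\<bar> * (\<integral>\<^sup>+\<omega>. ennreal (F (X \<omega>) (c * Z \<omega>)) \<partial>M)"
    using nn_integral_X_Z[of "\<lambda>(x, z). ennreal (F x (c * z))"] by simp
  also have "\<dots> = ennreal \<bar>c\<bar> * ennreal (expectation (\<lambda>\<omega>. F (X \<omega>) (c * Z \<omega>)))"
    using nn_integral_eq_integral[OF int(2)] nonneg by simp
  also have "\<dots> = ennreal (\<bar>c\<bar> * expectation (\<lambda>\<omega>. F (X \<omega>) (c * Z \<omega>)))"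
    using nonneg by (simp add: ennreal_mult)
  finally show ?thesis
    using nonneg by (simp add: ennreal_le_iff)
qed

lemma integrable_risk:
  assumes "0 \<le> p" "p \<le> 1" "0 \<le> lam"
  shows "integrable M (\<lambda>\<omega>. (eta p (X \<omega> + \<sigma> * Z \<omega>) lam - X \<omega>)\<^sup>2)"
proof (rule Bochner_Integration.integrable_bound)
  show "integrable M (\<lambda>\<omega>. 8 * (X \<omega>)\<^sup>2 + 2 * \<sigma>\<^sup>2 * (Z \<omega>)\<^sup>2)"
    using integrable_square_X square_Z(1) by auto
  have "(\<lambda>\<omega>. eta p (X \<omega> + \<sigma> * Z \<omega>) lam) \<in> borel_measurable M"
    using borel_measurable_eta[OF assms] by measurable
  then show "(\<lambda>\<omega>. (eta p (X \<omega> + \<sigma> * Z \<omega>) lam - X \<omega>)\<^sup>2) \<in> borel_measurable M"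
    by measurable
  show "AE \<omega> in M. norm ((eta p (X \<omega> + \<sigma> * Z \<omega>) lam - X \<omega>)\<^sup>2) \<le> norm (8 * (X \<omega>)\<^sup>2 + 2 * \<sigma>\<^sup>2 * (Z \<omega>)\<^sup>2)"
    using square_eta_error_le[OF assms, of "X _" "\<sigma> * Z _"]
    by (intro always_eventually) (auto simp: power_mult_distrib mult.assoc)
qed

lemma risk_eq: "risk M X Z \<sigma> lam p = expectation (\<lambda>\<omega>. (eta p (X \<omega> + \<sigma> * Z \<omega>) lam - X \<omega>)\<^sup>2)"
  by (simp add: risk_def)

lemma risk_dilation_le:
  assumes "0 \<le> p" "p \<le> 1" "0 \<le> lam" "0 < s" "s \<le> \<sigma>"
  shows "s * risk M X Z s lam p \<le> \<sigma> * risk M X Z \<sigma> lam p"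
proof -
  define F where "F x z = (eta p (x + s * z) lam - x)\<^sup>2" for x z
  have "(\<lambda>(x, z). eta p (x + s * z) lam) \<in> borel_measurable (borel \<Otimes>\<^sub>M borel)"
    using borel_measurable_eta[OF assms(1-3)] by measurable
  then have "case_prod F \<in> borel_measurable (borel \<Otimes>\<^sub>M borel)"
    unfolding F_def by measurable
  then have "expectation (\<lambda>\<omega>. F (X \<omega>) (Z \<omega>)) \<le> \<bar>\<sigma> / s\<bar> * expectation (\<lambda>\<omega>. F (X \<omega>) (\<sigma> / s * Z \<omega>))"
    using assms integrable_risk[OF assms(1-3), of s] integrable_risk[OF assms(1-3), of \<sigma>]
    by (intro expectation_dilation_le) (auto simp: F_def field_simps)
  then have "risk M X Z s lam p \<le> \<sigma> / s * risk M X Z \<sigma> lam p"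
    using assms by (simp add: F_def risk_eq)
  then show ?thesis
    using assms by (simp add: field_simps)
qed

end

section \<open>Risk under optimal tuning\<close>

definition opt_risk :: "'a measure \<Rightarrow> ('a \<Rightarrow> real) \<Rightarrow> ('a \<Rightarrow> real) \<Rightarrow> real \<Rightarrow> real" where
  "opt_risk M X Z \<sigma> = (INF (lam, p) \<in> {0..} \<times> {0..1}. risk M X Z \<sigma> lam p)"

lemma opt_risk_le:
  assumes "0 \<le> lam" "0 \<le> p" "p \<le> 1"
  shows "opt_risk M X Z \<sigma> \<le> risk M X Z \<sigma> lam p"
proof -
  have "bdd_below ((\<lambda>(lam, p). risk M X Z \<sigma> lam p) ` ({0..} \<times> {0..1}))"
    by (intro bdd_belowI2[where m = 0]) (auto simp: risk_def)
  then have "opt_risk M X Z \<sigma> \<le> (case (lam, p) of (lam, p) \<Rightarrow> risk M X Z \<sigma> lam p)"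
    unfolding opt_risk_def using assms by (intro cINF_lower) auto
  then show ?thesis by simp
qed

lemma opt_risk_greatest:
  assumes "\<And>lam p. 0 \<le> lam \<Longrightarrow> 0 \<le> p \<Longrightarrow> p \<le> 1 \<Longrightarrow> c \<le> risk M X Z \<sigma> lam p"
  shows "c \<le> opt_risk M X Z \<sigma>"
  unfolding opt_risk_def using assms by (intro cINF_greatest) auto

lemma opt_risk_nonneg: "0 \<le> opt_risk M X Z \<sigma>"
  by (intro opt_risk_greatest) (simp add: risk_def)

context noisy_signal
begin

lemma opt_risk_dilation_le:
  assumes "0 < s" "s \<le> \<sigma>"
  shows "s * opt_risk M X Z s \<le> \<sigma> * opt_risk M X Z \<sigma>"
proof -
  have "s * opt_risk M X Z s / \<sigma> \<le> opt_risk M X Z \<sigma>"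
  proof (rule opt_risk_greatest)
    fix lam p :: real assume p: "0 \<le> lam" "0 \<le> p" "p \<le> 1"
    have "s * opt_risk M X Z s \<le> s * risk M X Z s lam p"
      using assms p by (intro mult_left_mono opt_risk_le) auto
    also have "\<dots> \<le> \<sigma> * risk M X Z \<sigma> lam p"
      using assms p by (intro risk_dilation_le)
    finally show "s * opt_risk M X Z s / \<sigma> \<le> risk M X Z \<sigma> lam p"
      using assms by (simp add: field_simps)
  qed
  then show ?thesis
    using assms by (simp add: field_simps)
qed

text \<open>With this choice of weight, scale equivariance turns the conditional risk at
  \<open>X = x\<close> into \<open>\<sigma>\<^sup>2 * gauss_risk p tau (x / \<sigma>)\<close>, so
  one pair \<open>p\<close>, \<open>tau\<close> serves all noise levels.\<close>

lemma risk_le_minimax: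
  assumes p: "0 \<le> p" "p \<le> 1" and tau: "0 \<le> tau" and b: "\<And>mu. gauss_risk p tau mu \<le> b"
    and \<sigma>: "0 < \<sigma>"
  defines "\<epsilon> \<equiv> prob {\<omega> \<in> space M. X \<omega> \<noteq> 0}"
  shows "risk M X Z \<sigma> (\<sigma> powr (2 - p) * tau) p \<le> \<sigma>\<^sup>2 * ((1 - \<epsilon>) * gauss_risk p tau 0 + \<epsilon> * b)"
proof -
  define lam r where "lam = \<sigma> powr (2 - p) * tau" and "r = gauss_risk p tau"
  have lam: "0 \<le> lam"
    using tau by (simp add: lam_def)
  have r: "0 \<le> r mu" for mu
    by (simp add: r_def gauss_risk_nonneg[OF p tau])
  have "0 \<le> b"
    using r[of 0] b[of 0] by (simp add: r_def)
  have scale: "(eta p (x + \<sigma> * z) lam - x)\<^sup>2 = \<sigma>\<^sup>2 * (eta p (x / \<sigma> + z) tau - x / \<sigma>)\<^sup>2" for x z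
  proof -
    have "eta p (x + \<sigma> * z) lam - x = \<sigma> * (eta p (x / \<sigma> + z) tau - x / \<sigma>)"
      using eta_scale[OF \<sigma>, of p "x / \<sigma> + z" tau] \<sigma> by (simp add: lam_def algebra_simps)
    then show ?thesis
      by (simp add: power_mult_distrib)
  qed
  have [measurable]: "(\<lambda>(x, z). ennreal ((eta p (x + \<sigma> * z) lam - x)\<^sup>2)) \<in> borel_measurable (borel \<Otimes>\<^sub>M borel)"
  proof -
    have "(\<lambda>(x, z). eta p (x + \<sigma> * z) lam) \<in> borel_measurable (borel \<Otimes>\<^sub>M borel)"
      using borel_measurable_eta[OF p lam] by measurable
    then show ?thesis by measurable
  qed
  \<comment> \<open>A majorant of the conditional risk with only two values, according to whether
    the signal vanishes.\<close>
  define g where "g \<omega> = \<sigma>\<^sup>2 * (r 0 + (b - r 0) * indicat_real {\<omega> \<in> space M. X \<omega> \<noteq> 0} \<omega>)" for \<omega>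
  have g: "0 \<le> g \<omega>" for \<omega>
    using \<open>0 \<le> b\<close> r[of 0] by (auto simp: g_def indicator_def)
  have "integrable M (indicat_real {\<omega> \<in> space M. X \<omega> \<noteq> 0})"
    by (rule integrable_real_indicator) (auto simp: less_top[symmetric])
  then have int_g: "integrable M g"
    unfolding g_def by (intro integrable_mult_right Bochner_Integration.integrable_add) auto
  have "ennreal (risk M X Z \<sigma> lam p) = (\<integral>\<^sup>+\<omega>. ennreal ((eta p (X \<omega> + \<sigma> * Z \<omega>) lam - X \<omega>)\<^sup>2) \<partial>M)"
    unfolding risk_eq by (subst nn_integral_eq_integral) (auto intro: integrable_risk p lam)
  also have "\<dots> = (\<integral>\<^sup>+\<omega>. (\<integral>\<^sup>+z. ennreal ((eta p (X \<omega> + \<sigma> * z) lam - X \<omega>)\<^sup>2) \<partial>std_normal_distribution) \<partial>M)"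
    using nn_integral_X_Z[of "\<lambda>(x, z). ennreal ((eta p (x + \<sigma> * z) lam - x)\<^sup>2)"] by simp
  also have "\<dots> = (\<integral>\<^sup>+\<omega>. ennreal (\<sigma>\<^sup>2 * r (X \<omega> / \<sigma>)) \<partial>M)"
  proof (rule nn_integral_cong)
    fix \<omega>
    have meas: "(\<lambda>z. eta p (X \<omega> / \<sigma> + z) tau) \<in> borel_measurable borel"
      using borel_measurable_eta[OF p tau] by measurable
    have "(\<integral>\<^sup>+z. ennreal ((eta p (X \<omega> + \<sigma> * z) lam - X \<omega>)\<^sup>2) \<partial>std_normal_distribution)
        = ennreal (\<sigma>\<^sup>2) * (\<integral>\<^sup>+z. ennreal ((eta p (X \<omega> / \<sigma> + z) tau - X \<omega> / \<sigma>)\<^sup>2) \<partial>std_normal_distribution)"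
      unfolding scale using meas by (subst nn_integral_cmult[symmetric]) (auto simp: ennreal_mult)
    also have "\<dots> = ennreal (\<sigma>\<^sup>2 * r (X \<omega> / \<sigma>))"
      unfolding nn_integral_gauss_risk[OF p tau] by (simp add: r_def ennreal_mult r[unfolded r_def])
    finally show "(\<integral>\<^sup>+z. ennreal ((eta p (X \<omega> + \<sigma> * z) lam - X \<omega>)\<^sup>2) \<partial>std_normal_distribution)
        = ennreal (\<sigma>\<^sup>2 * r (X \<omega> / \<sigma>))" .
  qed
  also have "\<dots> \<le> (\<integral>\<^sup>+\<omega>. ennreal (g \<omega>) \<partial>M)"
    using b by (intro nn_integral_mono ennreal_leI) (auto simp: g_def r_def indicator_def intro!: mult_left_mono)
  also have "\<dots> = ennreal (expectation g)"
    by (rule nn_integral_eq_integral[OF int_g]) (simp add: g)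
  finally have "risk M X Z \<sigma> lam p \<le> expectation g"
    using g by (subst (asm) ennreal_le_iff) auto
  also have "expectation g = \<sigma>\<^sup>2 * (r 0 + (b - r 0) * \<epsilon>)"
    using \<open>integrable M (indicat_real _)\<close> by (simp add: g_def[abs_def] \<epsilon>_def prob_space)
  finally show ?thesis
    by (simp add: lam_def r_def algebra_simps)
qed

section \<open>Small-noise limit of the normalized optimal risk\<close>

lemma expectation_square_Z_on_support:
  "expectation (\<lambda>\<omega>. if X \<omega> \<noteq> 0 then (Z \<omega>)\<^sup>2 else 0) = prob {\<omega> \<in> space M. X \<omega> \<noteq> 0}"
proof -
  \<comment> \<open>Independence factors the expectation into the probability of a nonzero signal
    and the unit second moment of the noise.\<close>
  define u v :: "real \<Rightarrow> real" where "u = indicator (- {0})" and "v = (\<lambda>z. z\<^sup>2)"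
  have "indep_var borel (u \<circ> X) borel (v \<circ> Z)"
    by (rule indep_var_compose[OF indep_X_Z]) (auto simp: u_def v_def)
  then have "expectation (\<lambda>\<omega>. (u \<circ> X) \<omega> * (v \<circ> Z) \<omega>) = expectation (u \<circ> X) * expectation (v \<circ> Z)"
  proof (rule indep_var_lebesgue_integral)
    have "(u \<circ> X) \<in> borel_measurable M"
      by (auto simp: u_def)
    then show "integrable M (u \<circ> X)"
      by (rule integrable_const_bound[where B = 1, rotated]) (auto simp: u_def indicator_def)
    show "integrable M (v \<circ> Z)"
      using square_Z(1) by (simp add: v_def o_def)
  qed
  moreover have "expectation (v \<circ> Z) = 1"
    using square_Z(2) by (simp add: v_def o_def)
  moreover have "expectation (u \<circ> X) = expectation (indicator {\<omega> \<in> space M. X \<omega> \<noteq> 0})"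
    by (intro Bochner_Integration.integral_cong) (auto simp: u_def indicator_def)
  moreover have "expectation (\<lambda>\<omega>. (u \<circ> X) \<omega> * (v \<circ> Z) \<omega>) = expectation (\<lambda>\<omega>. if X \<omega> \<noteq> 0 then (Z \<omega>)\<^sup>2 else 0)"
    by (intro Bochner_Integration.integral_cong) (auto simp: u_def v_def indicator_def)
  ultimately show ?thesis
    by simp
qed

lemma integrable_square_Z_restrict:
  assumes "Measurable.pred M P"
  shows "integrable M (\<lambda>\<omega>. if P \<omega> then (Z \<omega>)\<^sup>2 else 0)"
  using assms by (intro Bochner_Integration.integrable_bound[OF square_Z(1)]) auto

text \<open>By symmetry of the noise, twice the risk dominates the mean of the errors at
  \<open>X + \<sigma> * Z\<close> and \<open>X - \<sigma> * Z\<close> added together, and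
  \<open>eta_symmetrized_error\<close> bounds that sum from below on the stated event.\<close>

lemma risk_ge:
  assumes p: "0 \<le> p" "p \<le> 1" "0 \<le> lam"
  shows "\<sigma>\<^sup>2 * expectation (\<lambda>\<omega>. if X \<omega> \<noteq> 0 \<and> 2 * \<bar>\<sigma> * Z \<omega>\<bar> \<le> \<bar>X \<omega>\<bar> then (Z \<omega>)\<^sup>2 else 0)
    \<le> risk M X Z \<sigma> lam p"
proof -
  \<comment> \<open>The minus sign makes the risk the flipped expectation, which is the larger side
    of the dilation inequality at \<open>c = - 1\<close>.\<close>
  define F where "F x z = (eta p (x - \<sigma> * z) lam - x)\<^sup>2" for x z
  have int: "integrable M (\<lambda>\<omega>. F (X \<omega>) (Z \<omega>))" "integrable M (\<lambda>\<omega>. F (X \<omega>) (- 1 * Z \<omega>))"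
    using integrable_risk[OF p, of "- \<sigma>"] integrable_risk[OF p, of \<sigma>] by (auto simp: F_def)
  have "(\<lambda>(x, z). eta p (x - \<sigma> * z) lam) \<in> borel_measurable (borel \<Otimes>\<^sub>M borel)"
    using borel_measurable_eta[OF p] by measurable
  then have "case_prod F \<in> borel_measurable (borel \<Otimes>\<^sub>M borel)"
    unfolding F_def by measurable
  then have sym: "expectation (\<lambda>\<omega>. F (X \<omega>) (Z \<omega>)) \<le> expectation (\<lambda>\<omega>. F (X \<omega>) (- 1 * Z \<omega>))"
    using expectation_dilation_le[of F "- 1"] int by (simp add: F_def)
  have risk: "risk M X Z \<sigma> lam p = expectation (\<lambda>\<omega>. F (X \<omega>) (- 1 * Z \<omega>))"
    by (simp add: risk_eq F_def)
  have "2 * (\<sigma>\<^sup>2 * expectation (\<lambda>\<omega>. if X \<omega> \<noteq> 0 \<and> 2 * \<bar>\<sigma> * Z \<omega>\<bar> \<le> \<bar>X \<omega>\<bar> then (Z \<omega>)\<^sup>2 else 0))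
      = expectation (\<lambda>\<omega>. 2 * (\<sigma>\<^sup>2 * (if X \<omega> \<noteq> 0 \<and> 2 * \<bar>\<sigma> * Z \<omega>\<bar> \<le> \<bar>X \<omega>\<bar> then (Z \<omega>)\<^sup>2 else 0)))"
    by simp
  also have "\<dots> \<le> expectation (\<lambda>\<omega>. F (X \<omega>) (- 1 * Z \<omega>) + F (X \<omega>) (Z \<omega>))"
  proof (rule integral_mono)
    show "integrable M (\<lambda>\<omega>. 2 * (\<sigma>\<^sup>2 * (if X \<omega> \<noteq> 0 \<and> 2 * \<bar>\<sigma> * Z \<omega>\<bar> \<le> \<bar>X \<omega>\<bar> then (Z \<omega>)\<^sup>2 else 0)))"
      by (intro integrable_mult_right integrable_square_Z_restrict) measurable
    show "integrable M (\<lambda>\<omega>. F (X \<omega>) (- 1 * Z \<omega>) + F (X \<omega>) (Z \<omega>))"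
      using int by auto
    show "2 * (\<sigma>\<^sup>2 * (if X \<omega> \<noteq> 0 \<and> 2 * \<bar>\<sigma> * Z \<omega>\<bar> \<le> \<bar>X \<omega>\<bar> then (Z \<omega>)\<^sup>2 else 0))
        \<le> F (X \<omega>) (- 1 * Z \<omega>) + F (X \<omega>) (Z \<omega>)" for \<omega>
      using eta_symmetrized_error[OF p, of "\<sigma> * Z \<omega>" "X \<omega>"] by (auto simp: F_def power_mult_distrib)
  qed
  also have "\<dots> \<le> 2 * risk M X Z \<sigma> lam p"
    using int sym by (simp add: risk)
  finally show ?thesis by simp
qed

text \<open>This weight puts the hard threshold at \<open>\<sigma> * t\<close>. The three terms are
  the noise on a retained signal, the noise that passes the threshold when \<open>X = 0\<close>, and
  a nonzero signal that is suppressed; suppression forces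
  \<open>\<bar>X\<bar> \<le> \<sigma> * (t + \<bar>Z\<bar>)\<close>.\<close>

lemma risk_hard_threshold_le:
  assumes "0 < t" "0 < \<sigma>"
  shows "risk M X Z \<sigma> ((\<sigma> * t)\<^sup>2 / 2) 0 \<le> \<sigma>\<^sup>2 * (prob {\<omega> \<in> space M. X \<omega> \<noteq> 0}
    + expectation (\<lambda>\<omega>. if t \<le> \<bar>Z \<omega>\<bar> then (Z \<omega>)\<^sup>2 else 0)
    + expectation (\<lambda>\<omega>. if X \<omega> \<noteq> 0 \<and> \<bar>X \<omega>\<bar> \<le> \<sigma> * (t + \<bar>Z \<omega>\<bar>) then (t + \<bar>Z \<omega>\<bar>)\<^sup>2 else 0))"
proof -
  define lam where "lam = (\<sigma> * t)\<^sup>2 / 2"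
  have lam: "0 < lam" "2 * lam = (\<sigma> * t)\<^sup>2"
    using assms by (auto simp: lam_def)
  define A where "A \<omega> = (if X \<omega> \<noteq> 0 then (Z \<omega>)\<^sup>2 else 0)" for \<omega>
  define B where "B \<omega> = (if t \<le> \<bar>Z \<omega>\<bar> then (Z \<omega>)\<^sup>2 else 0)" for \<omega>
  define C where "C \<omega> = (if X \<omega> \<noteq> 0 \<and> \<bar>X \<omega>\<bar> \<le> \<sigma> * (t + \<bar>Z \<omega>\<bar>) then (t + \<bar>Z \<omega>\<bar>)\<^sup>2 else 0)" for \<omega>
  have int: "integrable M A" "integrable M B"
    unfolding A_def B_def by (intro integrable_square_Z_restrict; measurable)+
  have intC: "integrable M C"
  proof (rule Bochner_Integration.integrable_bound)
    show "integrable M (\<lambda>\<omega>. 2 * t\<^sup>2 + 2 * (Z \<omega>)\<^sup>2)"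
      using square_Z(1) by auto
    show "C \<in> borel_measurable M"
      unfolding C_def by measurable
    show "AE \<omega> in M. norm (C \<omega>) \<le> norm (2 * t\<^sup>2 + 2 * (Z \<omega>)\<^sup>2)"
      using square_sum_le[of t "\<bar>Z _\<bar>"] by (intro always_eventually) (auto simp: C_def)
  qed
  have "risk M X Z \<sigma> lam 0 \<le> expectation (\<lambda>\<omega>. \<sigma>\<^sup>2 * (A \<omega> + B \<omega> + C \<omega>))"
    unfolding risk_eq
  proof (rule integral_mono)
    show "integrable M (\<lambda>\<omega>. (eta 0 (X \<omega> + \<sigma> * Z \<omega>) lam - X \<omega>)\<^sup>2)"
      using lam by (intro integrable_risk) auto
    show "integrable M (\<lambda>\<omega>. \<sigma>\<^sup>2 * (A \<omega> + B \<omega> + C \<omega>))"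
      using int intC by auto
    fix \<omega>
    have nonneg: "0 \<le> A \<omega>" "0 \<le> B \<omega>" "0 \<le> C \<omega>"
      by (auto simp: A_def B_def C_def)
    define e where "e = (eta 0 (X \<omega> + \<sigma> * Z \<omega>) lam - X \<omega>)\<^sup>2"
    have "e \<le> \<sigma>\<^sup>2 * A \<omega> \<or> e \<le> \<sigma>\<^sup>2 * B \<omega> \<or> e \<le> \<sigma>\<^sup>2 * C \<omega>"
    proof (cases "X \<omega> = 0")
      case True
      show ?thesis
      proof (cases "t \<le> \<bar>Z \<omega>\<bar>")
        case True
        then have "e \<le> \<sigma>\<^sup>2 * B \<omega>"
          using eta_0(1)[OF lam(1), of "\<sigma> * Z \<omega>"] \<open>X \<omega> = 0\<close>
          by (auto simp: e_def B_def power_mult_distrib)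
        then show ?thesis by simp
      next
        case False
        then have "\<bar>\<sigma> * Z \<omega>\<bar> < \<bar>\<sigma> * t\<bar>"
          using assms by (simp add: abs_mult)
        then have "(\<sigma> * Z \<omega>)\<^sup>2 < 2 * lam"
          unfolding lam(2) using power_strict_mono[of "\<bar>\<sigma> * Z \<omega>\<bar>" "\<bar>\<sigma> * t\<bar>" 2] by simp
        then have "e = 0"
          using eta_0(2)[OF lam(1)] \<open>X \<omega> = 0\<close> by (simp add: e_def)
        then show ?thesis
          using nonneg by simp
      qed
    next
      case False
      consider "eta 0 (X \<omega> + \<sigma> * Z \<omega>) lam = X \<omega> + \<sigma> * Z \<omega>"
        | "eta 0 (X \<omega> + \<sigma> * Z \<omega>) lam = 0" "(X \<omega> + \<sigma> * Z \<omega>)\<^sup>2 \<le> (\<sigma> * t)\<^sup>2"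
        using eta_0(1)[OF lam(1), of "X \<omega> + \<sigma> * Z \<omega>"] lam(2) by auto
      then show ?thesis
      proof cases
        case 1
        then show ?thesis
          using False by (simp add: e_def A_def power_mult_distrib)
      next
        case 2
        have "\<bar>X \<omega> + \<sigma> * Z \<omega>\<bar> \<le> \<sigma> * t"
          using 2(2) assms by (simp flip: abs_le_square_iff)
        moreover have "\<bar>\<sigma> * Z \<omega>\<bar> = \<sigma> * \<bar>Z \<omega>\<bar>"
          using assms by (simp add: abs_mult)
        ultimately have *: "\<bar>X \<omega>\<bar> \<le> \<sigma> * (t + \<bar>Z \<omega>\<bar>)"
          by (simp add: distrib_left)
        then have "\<bar>X \<omega>\<bar>\<^sup>2 \<le> (\<sigma> * (t + \<bar>Z \<omega>\<bar>))\<^sup>2"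
          by (intro power_mono) auto
        then have "e \<le> \<sigma>\<^sup>2 * C \<omega>"
          using False * 2(1) by (simp add: e_def C_def power_mult_distrib)
        then show ?thesis by simp
      qed
    qed
    then show "(eta 0 (X \<omega> + \<sigma> * Z \<omega>) lam - X \<omega>)\<^sup>2 \<le> \<sigma>\<^sup>2 * (A \<omega> + B \<omega> + C \<omega>)"
      using mult_left_mono[OF nonneg(1), of "\<sigma>\<^sup>2"] mult_left_mono[OF nonneg(2), of "\<sigma>\<^sup>2"]
        mult_left_mono[OF nonneg(3), of "\<sigma>\<^sup>2"]
      unfolding e_def[symmetric] distrib_left by auto
  qed
  also have "\<dots> = \<sigma>\<^sup>2 * (expectation A + expectation B + expectation C)"
    using int intC by simp
  also have "expectation A = prob {\<omega> \<in> space M. X \<omega> \<noteq> 0}"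
    unfolding A_def by (rule expectation_square_Z_on_support)
  finally show ?thesis
    unfolding lam_def B_def C_def by simp
qed

lemma opt_risk_ratio_tendsto:
  "((\<lambda>\<sigma>. opt_risk M X Z \<sigma> / \<sigma>\<^sup>2) \<longlongrightarrow> prob {\<omega> \<in> space M. X \<omega> \<noteq> 0}) (at_right 0)"
proof -
  define \<epsilon> where "\<epsilon> = prob {\<omega> \<in> space M. X \<omega> \<noteq> 0}"
  define low where "low \<sigma> = expectation (\<lambda>\<omega>. if X \<omega> \<noteq> 0 \<and> 2 * \<bar>\<sigma> * Z \<omega>\<bar> \<le> \<bar>X \<omega>\<bar> then (Z \<omega>)\<^sup>2 else 0)" for \<sigma>
  define tail where "tail t = expectation (\<lambda>\<omega>. if t \<le> \<bar>Z \<omega>\<bar> then (Z \<omega>)\<^sup>2 else 0)" for t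
  define rest where "rest t \<sigma> = expectation (\<lambda>\<omega>. if X \<omega> \<noteq> 0 \<and> \<bar>X \<omega>\<bar> \<le> \<sigma> * (t + \<bar>Z \<omega>\<bar>) then (t + \<bar>Z \<omega>\<bar>)\<^sup>2 else 0)" for t \<sigma>
  \<comment> \<open>Sequences give access to dominated convergence: where \<open>X\<close> is
    nonzero the event eventually holds, and \<open>Z\<^sup>2\<close> is a majorant.\<close>
  have low: "(low \<longlongrightarrow> \<epsilon>) (at_right 0)"
  proof (rule tendsto_at_right_sequentially[of 0 1])
    fix S :: "nat \<Rightarrow> real" assume S: "S \<longlonglongrightarrow> 0"
    show "(\<lambda>n. low (S n)) \<longlonglongrightarrow> \<epsilon>"
      unfolding low_def \<epsilon>_def expectation_square_Z_on_support[symmetric]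
    proof (rule integral_dominated_convergence[where w = "\<lambda>\<omega>. (Z \<omega>)\<^sup>2"])
      show "AE \<omega> in M. (\<lambda>n. if X \<omega> \<noteq> 0 \<and> 2 * \<bar>S n * Z \<omega>\<bar> \<le> \<bar>X \<omega>\<bar> then (Z \<omega>)\<^sup>2 else 0)
          \<longlonglongrightarrow> (if X \<omega> \<noteq> 0 then (Z \<omega>)\<^sup>2 else 0)"
      proof (intro always_eventually allI)
        fix \<omega>
        show "(\<lambda>n. if X \<omega> \<noteq> 0 \<and> 2 * \<bar>S n * Z \<omega>\<bar> \<le> \<bar>X \<omega>\<bar> then (Z \<omega>)\<^sup>2 else 0)
          \<longlonglongrightarrow> (if X \<omega> \<noteq> 0 then (Z \<omega>)\<^sup>2 else 0)"
        proof (cases "X \<omega> = 0")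
          case False
          have "(\<lambda>n. 2 * \<bar>S n * Z \<omega>\<bar>) \<longlonglongrightarrow> 2 * \<bar>0 * Z \<omega>\<bar>"
            by (intro tendsto_intros S)
          then have "\<forall>\<^sub>F n in sequentially. 2 * \<bar>S n * Z \<omega>\<bar> < \<bar>X \<omega>\<bar>"
            by (rule order_tendstoD(2)) (use False in simp)
          then show ?thesis
            by (intro tendsto_eventually, eventually_elim) (use False in auto)
        qed simp
      qed
    qed (use square_Z(1) in auto)
  qed auto
  \<comment> \<open>For fixed \<open>t\<close>, a nonzero signal eventually exceeds
    \<open>\<sigma> * (t + \<bar>Z\<bar>)\<close>, so the integrand vanishes pointwise.\<close>
  have rest: "(rest t \<longlongrightarrow> 0) (at_right 0)" for t
  proof (rule tendsto_at_right_sequentially[of 0 1])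
    fix S :: "nat \<Rightarrow> real" assume S: "S \<longlonglongrightarrow> 0"
    have "(\<lambda>n. rest t (S n)) \<longlonglongrightarrow> expectation (\<lambda>\<omega>. 0)"
      unfolding rest_def
    proof (rule integral_dominated_convergence[where w = "\<lambda>\<omega>. 2 * t\<^sup>2 + 2 * (Z \<omega>)\<^sup>2"])
      show "AE \<omega> in M. (\<lambda>n. if X \<omega> \<noteq> 0 \<and> \<bar>X \<omega>\<bar> \<le> S n * (t + \<bar>Z \<omega>\<bar>) then (t + \<bar>Z \<omega>\<bar>)\<^sup>2 else 0) \<longlonglongrightarrow> 0"
      proof (intro always_eventually allI)
        fix \<omega>
        show "(\<lambda>n. if X \<omega> \<noteq> 0 \<and> \<bar>X \<omega>\<bar> \<le> S n * (t + \<bar>Z \<omega>\<bar>) then (t + \<bar>Z \<omega>\<bar>)\<^sup>2 else 0) \<longlonglongrightarrow> 0"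
        proof (cases "X \<omega> = 0")
          case False
          have "(\<lambda>n. S n * (t + \<bar>Z \<omega>\<bar>)) \<longlonglongrightarrow> 0 * (t + \<bar>Z \<omega>\<bar>)"
            by (intro tendsto_intros S)
          then have "\<forall>\<^sub>F n in sequentially. S n * (t + \<bar>Z \<omega>\<bar>) < \<bar>X \<omega>\<bar>"
            by (rule order_tendstoD(2)) (use False in simp)
          then show ?thesis
            by (intro tendsto_eventually, eventually_elim) auto
        qed simp
      qed
      show "AE \<omega> in M. norm (if X \<omega> \<noteq> 0 \<and> \<bar>X \<omega>\<bar> \<le> S n * (t + \<bar>Z \<omega>\<bar>) then (t + \<bar>Z \<omega>\<bar>)\<^sup>2 else 0)
          \<le> 2 * t\<^sup>2 + 2 * (Z \<omega>)\<^sup>2" for n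
        using square_sum_le[of t "\<bar>Z _\<bar>"] by (intro always_eventually) auto
    qed (use square_Z(1) in auto)
    then show "(\<lambda>n. rest t (S n)) \<longlonglongrightarrow> 0"
      by simp
  qed auto
  have tail: "(\<lambda>n. tail (real n)) \<longlonglongrightarrow> 0"
  proof -
    have "(\<lambda>n. tail (real n)) \<longlonglongrightarrow> expectation (\<lambda>\<omega>. 0)"
      unfolding tail_def
    proof (rule integral_dominated_convergence[where w = "\<lambda>\<omega>. (Z \<omega>)\<^sup>2"])
      show "AE \<omega> in M. (\<lambda>n. if real n \<le> \<bar>Z \<omega>\<bar> then (Z \<omega>)\<^sup>2 else 0) \<longlonglongrightarrow> 0"
      proof (intro always_eventually allI)
        fix \<omega>
        have "\<forall>\<^sub>F n in sequentially. \<bar>Z \<omega>\<bar> < real n"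
          using filterlim_real_sequentially by (auto simp: filterlim_at_top_dense)
        then show "(\<lambda>n. if real n \<le> \<bar>Z \<omega>\<bar> then (Z \<omega>)\<^sup>2 else 0) \<longlonglongrightarrow> 0"
          by (intro tendsto_eventually, eventually_elim) auto
      qed
    qed (use square_Z(1) in auto)
    then show ?thesis by simp
  qed
  have pos: "\<forall>\<^sub>F \<sigma> in at_right 0. (0::real) < \<sigma>"
    by (rule eventually_at_right_less)
  show ?thesis
    unfolding \<epsilon>_def[symmetric]
  proof (rule order_tendstoI)
    fix a assume "a < \<epsilon>"
    with low have "\<forall>\<^sub>F \<sigma> in at_right 0. a < low \<sigma>"
      by (rule order_tendstoD)
    with pos show "\<forall>\<^sub>F \<sigma> in at_right 0. a < opt_risk M X Z \<sigma> / \<sigma>\<^sup>2"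
    proof eventually_elim
      case (elim \<sigma>)
      have "\<sigma>\<^sup>2 * low \<sigma> \<le> opt_risk M X Z \<sigma>"
        unfolding low_def by (intro opt_risk_greatest risk_ge)
      then have "low \<sigma> \<le> opt_risk M X Z \<sigma> / \<sigma>\<^sup>2"
        using elim by (simp add: field_simps)
      with elim show ?case by simp
    qed
  next
    fix a assume "\<epsilon> < a"
    \<comment> \<open>Half of the gap goes to \<open>tail\<close>, which fixes the threshold
      \<open>n\<close>; only then does \<open>\<sigma>\<close> shrink to push \<open>rest\<close>
      below the other half.\<close>
    define d where "d = (a - \<epsilon>) / 2"
    have d: "0 < d" "a = \<epsilon> + d + d"
      using \<open>\<epsilon> < a\<close> by (auto simp: d_def field_simps)
    have "\<forall>\<^sub>F n in sequentially. tail (real n) < d"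
      using tail d(1) by (rule order_tendstoD)
    moreover have "\<forall>\<^sub>F n in sequentially. 0 < n"
      by (rule eventually_gt_at_top)
    ultimately have "\<forall>\<^sub>F n in sequentially. tail (real n) < d \<and> 0 < n"
      by (rule eventually_conj)
    then obtain n where n: "tail (real n) < d" "0 < n"
      unfolding eventually_sequentially by blast
    have "\<forall>\<^sub>F \<sigma> in at_right 0. rest (real n) \<sigma> < d"
      using rest d(1) by (rule order_tendstoD)
    with pos show "\<forall>\<^sub>F \<sigma> in at_right 0. opt_risk M X Z \<sigma> / \<sigma>\<^sup>2 < a"
    proof eventually_elim
      case (elim \<sigma>)
      have "opt_risk M X Z \<sigma> \<le> risk M X Z \<sigma> ((\<sigma> * real n)\<^sup>2 / 2) 0"
        by (intro opt_risk_le) auto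
      also have "\<dots> \<le> \<sigma>\<^sup>2 * (\<epsilon> + tail (real n) + rest (real n) \<sigma>)"
        unfolding \<epsilon>_def tail_def rest_def using elim n by (intro risk_hard_threshold_le) auto
      finally have "opt_risk M X Z \<sigma> / \<sigma>\<^sup>2 \<le> \<epsilon> + tail (real n) + rest (real n) \<sigma>"
        using elim by (simp add: field_simps)
      with n elim d show ?case by simp
    qed
  qed
qed

end

section \<open>The highest fixed point\<close>

text \<open>Knaster--Tarski for the monotone map \<open>\<sigma> \<mapsto> (\<sigma> * F \<sigma>)\<^bsup>1/3\<^esup>\<close>, whose positive fixed points are those
  of \<open>F \<sigma> = \<sigma>\<^sup>2\<close>; no continuity of \<open>F\<close> is required.\<close>

lemma greatest_fixed_point:
  fixes F :: "real \<Rightarrow> real"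
  assumes a: "0 < a" and lower: "a\<^sup>2 \<le> F a"
    and mono: "\<And>s t. 0 < s \<Longrightarrow> s \<le> t \<Longrightarrow> s * F s \<le> t * F t"
    and upper: "\<And>s. 0 < s \<Longrightarrow> F s \<le> a\<^sup>2 + k * s\<^sup>2" and k: "k < 1"
  defines "s \<equiv> GREATEST \<sigma>. 0 \<le> \<sigma> \<and> F \<sigma> = \<sigma>\<^sup>2"
  shows "a \<le> s" "s\<^sup>2 \<le> a\<^sup>2 / (1 - k)" "F s = s\<^sup>2"
proof -
  \<comment> \<open>These are the positive points that the cube-root map does not decrease.\<close>
  define S where "S = {\<sigma>. 0 < \<sigma> \<and> \<sigma>\<^sup>2 \<le> F \<sigma>}"
  have "a \<in> S"
    using a lower by (simp add: S_def)
  have bound: "\<sigma>\<^sup>2 \<le> a\<^sup>2 / (1 - k)" if "\<sigma> \<in> S" for \<sigma>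
    using upper[of \<sigma>] that k by (simp add: S_def field_simps)
  have bdd: "bdd_above S"
  proof (rule bdd_aboveI)
    show "\<sigma> \<le> sqrt (a\<^sup>2 / (1 - k))" if "\<sigma> \<in> S" for \<sigma>
      using real_sqrt_le_mono[OF bound[OF that]] that by (simp add: S_def)
  qed
  define m where "m = Sup S"
  have le_m: "\<sigma> \<le> m" if "\<sigma> \<in> S" for \<sigma>
    unfolding m_def using that bdd by (rule cSup_upper)
  have "0 < m"
    using le_m[OF \<open>a \<in> S\<close>] a by simp
  have cube: "\<sigma> ^ 3 \<le> m * F m" if "\<sigma> \<in> S" for \<sigma>
  proof -
    have "\<sigma> ^ 3 = \<sigma> * \<sigma>\<^sup>2"
      by (simp add: power3_eq_cube power2_eq_square)
    also have "\<dots> \<le> \<sigma> * F \<sigma>"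
      using that by (simp add: S_def)
    also have "\<dots> \<le> m * F m"
      using that le_m[OF that] by (intro mono) (auto simp: S_def)
    finally show ?thesis .
  qed
  \<comment> \<open>The image of \<open>m\<close> bounds \<open>S\<close> from above, so the
    supremum itself belongs to \<open>S\<close>.\<close>
  have "m \<le> root 3 (m * F m)"
    unfolding m_def
  proof (rule cSup_least)
    show "S \<noteq> {}" using \<open>a \<in> S\<close> by auto
    fix \<sigma> assume "\<sigma> \<in> S"
    then have "root 3 (\<sigma> ^ 3) \<le> root 3 (m * F m)"
      using cube by simp
    then show "\<sigma> \<le> root 3 (Sup S * F (Sup S))"
      by (simp add: m_def odd_real_root_power_cancel)
  qed
  then have "m ^ 3 \<le> root 3 (m * F m) ^ 3"
    using \<open>0 < m\<close> by (intro power_mono) auto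
  then have "m ^ 3 \<le> m * F m"
    by (simp add: odd_real_root_pow)
  then have "m * m\<^sup>2 \<le> m * F m"
    by (simp add: power3_eq_cube power2_eq_square)
  then have "m \<in> S"
    using \<open>0 < m\<close> by (simp add: S_def)
  have "F m = m\<^sup>2"
  proof (rule antisym)
    show "m\<^sup>2 \<le> F m"
      using \<open>m \<in> S\<close> by (simp add: S_def)
    show "F m \<le> m\<^sup>2"
    proof (rule ccontr)
      assume "\<not> F m \<le> m\<^sup>2"
      \<comment> \<open>The image of \<open>m\<close> would be a member of \<open>S\<close> beyond
        its supremum.\<close>
      define t where "t = root 3 (m * F m)"
      have "m ^ 3 < m * F m"
        using \<open>\<not> F m \<le> m\<^sup>2\<close> \<open>0 < m\<close> by (simp add: power3_eq_cube power2_eq_square)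
      then have "root 3 (m ^ 3) < t"
        unfolding t_def by simp
      then have "m < t"
        by (simp add: odd_real_root_power_cancel)
      have "t * t\<^sup>2 = m * F m"
        using odd_real_root_pow[of 3 "m * F m"] by (simp add: t_def power3_eq_cube power2_eq_square)
      also have "\<dots> \<le> t * F t"
        using \<open>0 < m\<close> \<open>m < t\<close> by (intro mono) auto
      finally have "t \<in> S"
        using \<open>0 < m\<close> \<open>m < t\<close> by (simp add: S_def)
      with le_m \<open>m < t\<close> show False by fastforce
    qed
  qed
  have "s = m"
    unfolding s_def
  proof (rule Greatest_equality)
    show "0 \<le> m \<and> F m = m\<^sup>2"
      using \<open>0 < m\<close> \<open>F m = m\<^sup>2\<close> by simp
    fix \<sigma> assume "0 \<le> \<sigma> \<and> F \<sigma> = \<sigma>\<^sup>2"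
    then show "\<sigma> \<le> m"
      using le_m[of \<sigma>] \<open>0 < m\<close> by (cases "\<sigma> = 0") (auto simp: S_def)
  qed
  then show "a \<le> s" "s\<^sup>2 \<le> a\<^sup>2 / (1 - k)" "F s = s\<^sup>2"
    using le_m[OF \<open>a \<in> S\<close>] bound[OF \<open>m \<in> S\<close>] \<open>F m = m\<^sup>2\<close> by auto
qed

section \<open>Ratio of the highest fixed point to the measurement noise\<close>

theorem theorem11:
  fixes M :: "'a measure" and X Z :: "'a \<Rightarrow> real" and \<delta> \<epsilon> :: real
  assumes "prob_space M"
    and "0 < \<delta>" and "\<delta> < 1"
    and "X \<in> borel_measurable M"
    and "integrable M (\<lambda>\<omega>. (X \<omega>)\<^sup>2)"
    and "measure M {\<omega> \<in> space M. X \<omega> \<noteq> 0} = \<epsilon>"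
    and "distributed M lborel Z std_normal_density"
    and "prob_space.indep_var M borel X borel Z"
    and "(INF p \<in> {0..1}. Mbar p \<epsilon>) < \<delta>"
  shows "((\<lambda>\<sigma>w. (highest_fixed_point M X Z \<delta> \<sigma>w)\<^sup>2 / \<sigma>w\<^sup>2) \<longlongrightarrow> 1 / (1 - \<epsilon> / \<delta>)) (at_right 0)"
proof -
  interpret prob_space M by fact
  interpret noisy_signal M X Z
    by unfold_locales fact+
  note \<delta> = \<open>0 < \<delta>\<close>
  have "0 \<le> \<epsilon>"
    using assms(6) measure_nonneg by metis
  then obtain p tau b D where minimax: "0 \<le> p" "p \<le> 1" "0 \<le> tau" "\<And>mu. gauss_risk p tau mu \<le> b"
      "(1 - \<epsilon>) * gauss_risk p tau 0 + \<epsilon> * b \<le> D" "D < \<delta>"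
    using minimax_witness[OF assms(9)] by metis
  define V h where "V = opt_risk M X Z" and "h = highest_fixed_point M X Z \<delta>"
  have V_le: "V \<sigma> \<le> D * \<sigma>\<^sup>2" if "0 < \<sigma>" for \<sigma>
  proof -
    have "V \<sigma> \<le> risk M X Z \<sigma> (\<sigma> powr (2 - p) * tau) p"
      unfolding V_def using minimax by (intro opt_risk_le) auto
    also have "\<dots> \<le> \<sigma>\<^sup>2 * ((1 - \<epsilon>) * gauss_risk p tau 0 + \<epsilon> * b)"
      using risk_le_minimax[OF minimax(1-4) that] assms(6) by simp
    also have "\<dots> \<le> \<sigma>\<^sup>2 * D"
      using minimax(5) by (intro mult_left_mono) auto
    finally show ?thesis by (simp add: mult.commute)
  qed
  have ratio: "((\<lambda>\<sigma>. V \<sigma> / \<sigma>\<^sup>2) \<longlongrightarrow> \<epsilon>) (at_right 0)"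
    using opt_risk_ratio_tendsto assms(6) by (simp add: V_def)
  \<comment> \<open>The ratio stays below \<open>D\<close> and tends to \<open>\<epsilon>\<close>;
    hence \<open>\<epsilon> < \<delta>\<close>, and the denominator of the limit is
    positive.\<close>
  have "\<epsilon> \<le> D"
  proof (rule tendsto_upperbound[OF ratio])
    show "\<forall>\<^sub>F \<sigma> in at_right 0. V \<sigma> / \<sigma>\<^sup>2 \<le> D"
      using eventually_at_right_less[of 0] by eventually_elim (use V_le in \<open>simp add: field_simps\<close>)
  qed simp
  have h: "a \<le> h a" "(h a)\<^sup>2 \<le> a\<^sup>2 / (1 - D / \<delta>)" "a\<^sup>2 + V (h a) / \<delta> = (h a)\<^sup>2" if "0 < a" for a
  proof -
    define F where "F \<sigma> = Psi M X Z \<delta> a (\<sigma>\<^sup>2)" for \<sigma>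
    \<comment> \<open>The sign condition enters because \<open>sqrt (\<sigma>\<^sup>2)\<close> is
      the absolute value of \<open>\<sigma>\<close>.\<close>
    have F: "F \<sigma> = a\<^sup>2 + V \<sigma> / \<delta>" if "0 \<le> \<sigma>" for \<sigma>
      using that by (simp add: F_def Psi_def V_def opt_risk_def)
    have h_eq: "h a = (GREATEST \<sigma>. 0 \<le> \<sigma> \<and> F \<sigma> = \<sigma>\<^sup>2)"
      by (simp add: h_def highest_fixed_point_def F_def)
    have lower: "a\<^sup>2 \<le> F a"
      using that \<delta> opt_risk_nonneg[of M X Z a] by (simp add: F V_def)
    \<comment> \<open>The constant noise floor contributes \<open>s * a\<^sup>2\<close>, which also
      increases with \<open>s\<close>.\<close>
    have mono: "s * F s \<le> t * F t" if "0 < s" "s \<le> t" for s t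
    proof -
      have "s * a\<^sup>2 + s * V s / \<delta> \<le> t * a\<^sup>2 + t * V t / \<delta>"
        using that \<delta> opt_risk_dilation_le[OF that]
        by (intro add_mono mult_right_mono divide_right_mono) (auto simp: V_def)
      then show ?thesis
        using that by (simp add: F distrib_left)
    qed
    have upper: "F s \<le> a\<^sup>2 + D / \<delta> * s\<^sup>2" if "0 < s" for s
      using V_le[OF that] that \<delta> by (simp add: F field_simps)
    have k: "D / \<delta> < 1"
      using minimax(6) \<delta> by simp
    note gfp = greatest_fixed_point[of a F "D / \<delta>", OF that lower mono upper k, folded h_eq]
    show "a \<le> h a" "(h a)\<^sup>2 \<le> a\<^sup>2 / (1 - D / \<delta>)"
      using gfp by auto
    then show "a\<^sup>2 + V (h a) / \<delta> = (h a)\<^sup>2"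
      using gfp(3) that by (simp add: F)
  qed
  \<comment> \<open>The bound \<open>a \<le> h a\<close> keeps \<open>h\<close> positive and the
    upper bound drives it to 0, so the small-noise limit may be evaluated along
    \<open>h\<close>.\<close>
  have "filterlim h (at_right 0) (at_right 0)"
    unfolding filterlim_at
  proof
    show "\<forall>\<^sub>F a in at_right 0. h a \<in> {0<..} \<and> h a \<noteq> 0"
      using eventually_at_right_less[of 0] by eventually_elim (use h(1) in fastforce)
    show "(h \<longlongrightarrow> 0) (at_right 0)"
    proof (rule tendsto_sandwich)
      show "\<forall>\<^sub>F a in at_right 0. 0 \<le> h a"
        using eventually_at_right_less[of 0] by eventually_elim (use h(1) in fastforce)
      show "\<forall>\<^sub>F a in at_right 0. h a \<le> sqrt (a\<^sup>2 / (1 - D / \<delta>))"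
        using eventually_at_right_less[of 0] by eventually_elim (use h(2) in \<open>auto intro: real_le_rsqrt\<close>)
      have "((\<lambda>a::real. sqrt (a\<^sup>2 / (1 - D / \<delta>))) \<longlongrightarrow> sqrt (0\<^sup>2 / (1 - D / \<delta>))) (at_right 0)"
        using minimax(6) \<delta> by (intro tendsto_intros) auto
      then show "((\<lambda>a::real. sqrt (a\<^sup>2 / (1 - D / \<delta>))) \<longlongrightarrow> 0) (at_right 0)"
        by simp
    qed simp
  qed
  with ratio have "((\<lambda>a. V (h a) / (h a)\<^sup>2) \<longlongrightarrow> \<epsilon>) (at_right 0)"
    by (rule filterlim_compose)
  then have "((\<lambda>a. 1 / (1 - V (h a) / (h a)\<^sup>2 / \<delta>)) \<longlongrightarrow> 1 / (1 - \<epsilon> / \<delta>)) (at_right 0)"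
    using \<open>\<epsilon> \<le> D\<close> minimax(6) \<delta> by (intro tendsto_intros) auto
  \<comment> \<open>The fixed point equation divided by \<open>(h a)\<^sup>2\<close>, then
    inverted.\<close>
  moreover have "\<forall>\<^sub>F a in at_right 0. 1 / (1 - V (h a) / (h a)\<^sup>2 / \<delta>) = (h a)\<^sup>2 / a\<^sup>2"
    using eventually_at_right_less[of 0]
  proof eventually_elim
    case (elim a)
    have "0 < h a"
      using h(1)[OF elim] elim by simp
    then have "1 - V (h a) / (h a)\<^sup>2 / \<delta> = ((h a)\<^sup>2 - V (h a) / \<delta>) / (h a)\<^sup>2"
      by (simp add: diff_divide_distrib mult.commute)
    also have "(h a)\<^sup>2 - V (h a) / \<delta> = a\<^sup>2"
      using h(3)[OF elim] by simp
    finally show ?case by simp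
  qed
  ultimately show ?thesis
    unfolding h_def by (rule Lim_transform_eventually)
qed

end
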